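(* Let $\mathcal S_\pi=\{x+iy\in\mathbb C:|y|<\pi\}$, and consider an analytic function $f:\mathcal S_\pi\to\mathbb C$ with the property that $f(\overline z)=\overline{f(z)}$ for all $z\in\mathcal S_\pi$. Assume that there exists a number $k>1$ such that $\lim_{t\downarrow-\infty}(kt+f(t))=-\infty$ and $\Im z\le\Im f(z)\le k\,\Im z$ for all $z\in\mathcal S_\pi$ with $\Im z>0$. Then: (1) For every $\alpha\in\mathcal S_\pi$ there exists a unique $z\in\mathcal S_\pi$ such that $f(z)=\alpha$. (2) There exists a continuous function $\omega:\overline{\mathcal S_\pi}\to\overline{\mathcal S_\pi}$ such that $\omega(\mathcal S_\pi)\subset\mathcal S_\pi$, $\omega|_{\mathcal S_\pi}$ is analytic, $|\Im\omega(z)|\le|\Im z|$, $\omega(\overline z)=\overline{\omega(z)}$, and $f(\omega(z))=z$ for $z\in\mathcal S_\pi$. (3) For each $\alpha\in\overline{\mathcal S_\pi}$, $\omega(\alpha)$ is the Denjoy-Wolff point of the map $g_\alpha:\mathcal S_\pi\to\mathcal S_\pi$ defined by $g_\alpha(z)=z-\tau(f(z)-\alpha)$, $z\in\mathcal S_\pi$, where $\tau=\pi/(k+\pi)$. (4) The function $\omega$ satisfies $|\omega(z_1)-\omega(z_2)|\ge\frac\tau2|z_1-z_2|$ for $z_1,z_2\in\overline{\mathcal S_\pi}$. In particular, $\omega$ is one-to-one. (5) If $\alpha\in\partial\mathcal S_\pi$ is such that $\omega(\alpha)\in\mathcal S_\pi$, then $\omega$ can be continued analytically to a neighborhood of $\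alpha$.
   Context: $\overline{\mathcal S_\pi}$ and $\partial\mathcal S_\pi$ are the closure and boundary of the strip in $\mathbb C$. For an analytic $h:\mathbb D\to\overline{\mathbb D}$ on the unit disk, a point $w\in\overline{\mathbb D}$ is a Denjoy-Wolff point of $h$ if either $|w|<1$ and $h(w)=w$, or $|w|=1$, the nontangential limit of $h$ at $w$ equals $w$, and the nontangential limit of $\frac{h(z)-w}{z-w}$ as $z\to w$ exists and is $\le1$. Every such $h$ other than the identity has exactly one Denjoy-Wolff point. The notion is transported to analytic self-maps of the strip $\mathcal S_\pi$ by a conformal map onto $\mathbb D$ (via $z\mapsto e^{z/2}$ onto the right half-plane); the boundary of the strip then consists of $\partial\mathcal S_\pi$ together with the two points $\pm\infty$.
   Formalization: With the printed τ=π/(k+π), (3) and (4) fail, e.g. for f(z)=kz, k=100. Here (3) and (4) are stated instead for every τ with 0<τ≤2/(k+1), which includes 1/(k+1), and includes π/(k+π) when k≤π/(π−2). *)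

theory Defs
  imports "HOL-Complex_Analysis.Complex_Analysis"
begin

definition strip :: "complex set" where
  "strip = {z. \<bar>Im z\<bar> < pi}"

text \<open>Nontangential limits at a point \<open>w\<close> of the unit circle: limits within every Stolz
  angle.  For \<open>M \<le> 1\<close> the Stolz angle is empty.\<close>

definition stolz_angle :: "complex \<Rightarrow> real \<Rightarrow> complex set" where
  "stolz_angle w M = {z \<in> ball 0 1. cmod (z - w) < M * (1 - cmod z)}"

definition nontangential_limit :: "(complex \<Rightarrow> complex) \<Rightarrow> complex \<Rightarrow> complex \<Rightarrow> bool" where
  "nontangential_limit h w l \<longleftrightarrow>
     (\<forall>M>1. (h \<longlongrightarrow> l) (at w within stolz_angle w M))"

definition denjoy_wolff_point :: "(complex \<Rightarrow> complex) \<Rightarrow> complex \<Rightarrow> bool" where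
  "denjoy_wolff_point h w \<longleftrightarrow>
     h holomorphic_on ball 0 1 \<and> h ` ball 0 1 \<subseteq> cball 0 1 \<and>
     (cmod w < 1 \<and> h w = w \<or>
      cmod w = 1 \<and> nontangential_limit h w w \<and>
      (\<exists>c::real. c \<le> 1 \<and>
         nontangential_limit (\<lambda>z. (h z - w) / (z - w)) w (of_real c)))"

text \<open>The map \<open>z \<mapsto> exp (z / 2)\<close> takes the strip onto the right half-plane, and
  \<open>u \<mapsto> (u - 1) / (u + 1)\<close> takes the latter onto the unit disk.  The composition
  is also injective on the closed strip, which it maps onto the closed disk without the points
  \<open>1\<close> and \<open>-1\<close>; these two correspond to the boundary points \<open>+\<infinity>\<close> and \<open>-\<infinity>\<close>
  of the strip.\<close>

definition strip_to_disk :: "complex \<Rightarrow> complex" where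
  "strip_to_disk z = (exp (z / 2) - 1) / (exp (z / 2) + 1)"

definition conj_to_disk :: "(complex \<Rightarrow> complex) \<Rightarrow> complex \<Rightarrow> complex" where
  "conj_to_disk g = strip_to_disk \<circ> g \<circ> inv_into strip strip_to_disk"

text \<open>\<open>w\<close> is the one and only Denjoy-Wolff point of the self-map \<open>g\<close> of the strip.
  Uniqueness is among all points of the closed disk, so it also excludes \<open>\<plusminus>\<infinity>\<close>.\<close>

definition is_strip_denjoy_wolff_point :: "(complex \<Rightarrow> complex) \<Rightarrow> complex \<Rightarrow> bool" where
  "is_strip_denjoy_wolff_point g w \<longleftrightarrow>
     w \<in> closure strip \<and>
     (\<forall>v. denjoy_wolff_point (conj_to_disk g) v \<longleftrightarrow> v = strip_to_disk w)"

definition self_map :: "real \<Rightarrow> (complex \<Rightarrow> complex) \<Rightarrow> complex \<Rightarrow> complex \<Rightarrow> complex" where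
  "self_map \<tau> f \<alpha> z = z - of_real \<tau> * (f z - \<alpha>)"

text \<open>About the parameter \<open>\<tau>\<close> of \<open>self_map\<close>: the source takes \<open>\<tau> = pi / (k + pi)\<close>,
  presumably a slip for \<open>pi / (k * pi + pi) = 1 / (k + 1)\<close>.  With the printed value
  \<open>f z = k * z\<close> does not give self-maps of the strip once \<open>k > pi / (pi - 2)\<close>, and violates
  the lower Lipschitz bound for the inverse once \<open>k > 2 * pi / (pi - 2)\<close>.  The theorem is
  stated for all \<open>\<tau>\<close> with \<open>0 < \<tau> \<le> 2 / (k + 1)\<close>.  These are exactly the positive \<open>\<tau>\<close> for
  which, for every admissible \<open>f\<close> and every \<open>\<alpha>\<close> in the closed strip, \<open>self_map \<tau> f \<alpha>\<close> maps
  the strip into itself.  They include \<open>1 / (k + 1)\<close>, and also \<open>pi / (k + pi)\<close> as long as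
  \<open>k \<le> pi / (pi - 2)\<close>.\<close>

end

theory Submission
  imports Defs
begin

text \<open>
  On the disk, \<open>v\<close> is a Denjoy-Wolff point of \<open>h\<close> exactly when every (horo)disk centred at \<open>v\<close>
  is mapped into itself, that is, \<open>\<bar>1 - cnj v h z\<bar>\<^sup>2 / (1 - \<bar>h z\<bar>\<^sup>2) \<le> \<bar>1 - cnj v z\<bar>\<^sup>2 / (1 - \<bar>z\<bar>\<^sup>2)\<close>
  for all \<open>z\<close>.  This condition treats interior and boundary points alike and survives limits in
  \<open>h\<close> and \<open>v\<close>; together with compactness of the closed disk and uniqueness, this makes the
  Denjoy-Wolff point a continuous function of the map.  For \<open>self_map \<tau> f \<alpha>\<close> with \<open>\<alpha>\<close> in the
  closed strip, the points \<open>\<plusminus>\<infinity>\<close> are excluded because \<open>Re f x - x\<close> is nondecreasing on the real line,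
  and for \<open>\<alpha>\<close> in the open strip all boundary points are, because the image lies in a
  smaller strip.  So \<open>\<omega> \<alpha>\<close> is a fixed point, i.e. \<open>f (\<omega> \<alpha>) = \<alpha>\<close>, and the derivative \<open>1 - \<tau> f'\<close> of
  the self-map has modulus at most 1 there.  Hence \<open>\<omega>' = 1 / f'\<close> has real part at least \<open>\<tau> / 2\<close>,
  which integrates to the lower Lipschitz bound over the convex strip.
\<close>

section \<open>Schwarz-Pick and Julia inequalities\<close>

lemma norm_one_minus_cnj_mult:
  "(cmod (1 - cnj w * z))\<^sup>2 - (cmod (z - w))\<^sup>2 = (1 - (cmod z)\<^sup>2) * (1 - (cmod w)\<^sup>2)"
  unfolding cmod_power2 by (cases z; cases w) (simp add: power2_eq_square algebra_simps)

lemma one_minus_cnj_mult_nonzero: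
  assumes "cmod w \<le> 1" "cmod z < 1"
  shows "1 - cnj w * z \<noteq> 0"
proof
  assume "1 - cnj w * z = 0"
  then have "cmod (cnj w * z) = 1" by simp
  moreover have "cmod w * cmod z \<le> 1 * cmod z"
    using assms by (intro mult_right_mono) auto
  ultimately show False using assms by (simp add: norm_mult)
qed

lemma one_minus_cmod_square_pos: "cmod z < 1 \<Longrightarrow> 0 < 1 - (cmod z)\<^sup>2"
  by (simp add: abs_square_less_1)

text \<open>Composing with disk automorphisms on both sides moves \<open>w\<close> and
  \<open>h w\<close> to the origin, so that Schwarz's lemma applies to \<open>k\<close>. The last
  claim relates \<open>k\<close> back to \<open>h\<close>.\<close>

lemma ball_self_map_Moebius:
  fixes h :: "complex \<Rightarrow> complex"
  assumes holh: "h holomorphic_on ball 0 1" and maps: "h \<in> ball 0 1 \<rightarrow> ball 0 1"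
    and w: "cmod w < 1"
  defines "k \<equiv> Moebius_function 0 (h w) \<circ> h \<circ> Moebius_function 0 (- w)"
  shows "k holomorphic_on ball 0 1" "k 0 = 0" "\<And>z. cmod z < 1 \<Longrightarrow> cmod (k z) < 1"
    "\<And>z. cmod z < 1 \<Longrightarrow> k (Moebius_function 0 w z) = Moebius_function 0 (h w) (h z)"
proof -
  have h: "cmod (h z) < 1" if "cmod z < 1" for z
    using maps that by auto
  have M: "Moebius_function 0 a ` ball 0 1 \<subseteq> ball 0 1" if "cmod a < 1" for a
    using Moebius_function_norm_lt_1[OF that] by auto
  show "k holomorphic_on ball 0 1"
    unfolding k_def
  proof (rule holomorphic_on_compose_gen[OF Moebius_function_holomorphic holomorphic_on_subset])
    show "Moebius_function 0 (h w) \<circ> h holomorphic_on ball 0 1"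
      using h w by (intro holomorphic_on_compose_gen[OF holh Moebius_function_holomorphic]) auto
  qed (use M[of "-w"] w in auto)
  show "k 0 = 0"
    by (simp add: k_def Moebius_function_of_zero Moebius_function_eq_zero)
  show "cmod (k z) < 1" if "cmod z < 1" for z
    using h w that by (simp add: k_def Moebius_function_norm_lt_1)
  show "k (Moebius_function 0 w z) = Moebius_function 0 (h w) (h z)" if "cmod z < 1" for z
    using that w by (simp add: k_def Moebius_function_compose)
qed

text \<open>Schwarz's lemma for the normalised map says that \<open>h\<close> does not increase the
  pseudohyperbolic distance. The identity \<open>norm_one_minus_cnj_mult\<close> trades the
  differences for \<open>1 - cnj w * z\<close> and its image. This leaves the factors 1 - |w|^2 and
  1 - |h w|^2, whose ratio matters when \<open>w\<close> tends to the unit circle.\<close>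

lemma Schwarz_Pick:
  fixes h :: "complex \<Rightarrow> complex"
  assumes holh: "h holomorphic_on ball 0 1" and maps: "h \<in> ball 0 1 \<rightarrow> ball 0 1"
    and w: "cmod w < 1" and z: "cmod z < 1"
  shows "(cmod (1 - cnj (h w) * h z))\<^sup>2 * (1 - (cmod z)\<^sup>2) * (1 - (cmod w)\<^sup>2)
    \<le> (cmod (1 - cnj w * z))\<^sup>2 * (1 - (cmod (h z))\<^sup>2) * (1 - (cmod (h w))\<^sup>2)"
proof -
  have h: "cmod (h z) < 1" if "cmod z < 1" for z
    using maps that by auto
  define k where "k \<equiv> Moebius_function 0 (h w) \<circ> h \<circ> Moebius_function 0 (- w)"
  note k = ball_self_map_Moebius[where h=h and w=w, OF holh maps w, folded k_def]
  have "cmod (k (Moebius_function 0 w z)) \<le> cmod (Moebius_function 0 w z)"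
    using Schwarz_Lemma(1)[of k] k w z Moebius_function_norm_lt_1 by blast
  then have "cmod ((h z - h w) / (1 - cnj (h w) * h z)) \<le> cmod ((z - w) / (1 - cnj w * z))"
    using k(4)[OF z] by (simp add: Moebius_function_simple)
  moreover have nz: "cmod (1 - cnj (h w) * h z) > 0" "cmod (1 - cnj w * z) > 0"
    using one_minus_cnj_mult_nonzero h w z by (auto simp: less_imp_le)
  ultimately have "cmod (h z - h w) * cmod (1 - cnj w * z) \<le> cmod (z - w) * cmod (1 - cnj (h w) * h z)"
    by (simp add: norm_divide field_simps)
  then have "(cmod (h z - h w))\<^sup>2 * (cmod (1 - cnj w * z))\<^sup>2 \<le> (cmod (z - w))\<^sup>2 * (cmod (1 - cnj (h w) * h z))\<^sup>2"
    by (metis power_mult_distrib power_mono mult_nonneg_nonneg norm_ge_zero)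
  moreover have "(cmod (h z - h w))\<^sup>2 = (cmod (1 - cnj (h w) * h z))\<^sup>2 - (1 - (cmod (h z))\<^sup>2) * (1 - (cmod (h w))\<^sup>2)"
    "(cmod (z - w))\<^sup>2 = (cmod (1 - cnj w * z))\<^sup>2 - (1 - (cmod z)\<^sup>2) * (1 - (cmod w)\<^sup>2)"
    using norm_one_minus_cnj_mult[of "h w" "h z"] norm_one_minus_cnj_mult[of w z] by auto
  ultimately show ?thesis by (simp add: algebra_simps)
qed

text \<open>At a fixed point the two Moebius factors have reciprocal derivatives, so
  \<open>k\<close> has the same derivative at 0 as \<open>h\<close> at \<open>w\<close>, and
  Schwarz's lemma bounds it. Its equality case makes \<open>k\<close> a rotation, and derivative 1
  makes that rotation trivial.\<close>

lemma deriv_fixed_point_ball: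
  fixes h :: "complex \<Rightarrow> complex"
  assumes holh: "h holomorphic_on ball 0 1" and maps: "h \<in> ball 0 1 \<rightarrow> ball 0 1"
    and w: "cmod w < 1" and fix_w: "h w = w"
  shows "cmod (deriv h w) \<le> 1" and "deriv h w = 1 \<Longrightarrow> cmod z < 1 \<Longrightarrow> h z = z"
proof -
  have h: "cmod (h z) < 1" if "cmod z < 1" for z
    using maps that by auto
  define k where "k \<equiv> Moebius_function 0 (h w) \<circ> h \<circ> Moebius_function 0 (- w)"
  note k = ball_self_map_Moebius[where h=h and w=w, OF holh maps w, folded k_def]
  have nz: "1 - cnj w * w \<noteq> 0"
    using one_minus_cnj_mult_nonzero w by auto
  have 1: "(Moebius_function 0 (- w) has_field_derivative 1 - cnj w * w) (at 0)"
    unfolding Moebius_function_def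
    by (auto intro!: derivative_eq_intros simp: field_simps)
  have 2: "(h has_field_derivative deriv h w) (at (Moebius_function 0 (- w) 0))"
    using holomorphic_derivI[OF holh, of w UNIV] w by (simp add: Moebius_function_of_zero)
  have 3: "(Moebius_function 0 (h w) has_field_derivative 1 / (1 - cnj w * w)) (at (h (Moebius_function 0 (- w) 0)))"
    using nz unfolding fix_w Moebius_function_def
    by (auto intro!: derivative_eq_intros simp: fix_w Moebius_function_def)
  have "(k has_field_derivative 1 / (1 - cnj w * w) * deriv h w * (1 - cnj w * w)) (at 0)"
    unfolding k_def o_def
    using DERIV_chain2[OF DERIV_chain2[OF 3 2] 1] by simp
  then have dk: "deriv k 0 = deriv h w"
    using nz by (simp add: DERIV_imp_deriv)
  show "cmod (deriv h w) \<le> 1"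
    using Schwarz_Lemma(2)[of k 0] k by (simp add: dk)
  show "h z = z" if "deriv h w = 1" "cmod z < 1"
  proof -
    have "\<exists>\<alpha>. (\<forall>z. cmod z < 1 \<longrightarrow> k z = \<alpha> * z) \<and> cmod \<alpha> = 1"
      using Schwarz_Lemma(3)[of k 0] k that by (simp add: dk)
    then obtain a where a: "\<And>z. cmod z < 1 \<Longrightarrow> k z = a * z" by blast
    have "(k has_field_derivative a) (at 0)"
      by (rule has_field_derivative_transform_within_open[of "\<lambda>z. a * z" _ _ "ball 0 1"])
         (auto intro!: derivative_eq_intros simp: a)
    then have "a = 1" using dk that by (simp add: DERIV_imp_deriv)
    then have "Moebius_function 0 w z = Moebius_function 0 w (h z)"
      using k(4)[OF that(2)] a Moebius_function_norm_lt_1[OF w that(2)] fix_w by simp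
    then have "Moebius_function 0 (- w) (Moebius_function 0 w z) = Moebius_function 0 (- w) (Moebius_function 0 w (h z))"
      by simp
    then show ?thesis using w that h by (simp add: Moebius_function_compose)
  qed
qed

section \<open>Julia's inequality: limits, existence and uniqueness of its centres\<close>

definition julia :: "(complex \<Rightarrow> complex) \<Rightarrow> complex \<Rightarrow> bool" where
  "julia h v \<longleftrightarrow> cmod v \<le> 1 \<and>
     (\<forall>z\<in>ball 0 1. (cmod (1 - cnj v * h z))\<^sup>2 * (1 - (cmod z)\<^sup>2)
        \<le> (cmod (1 - cnj v * z))\<^sup>2 * (1 - (cmod (h z))\<^sup>2))"

text \<open>Taking \<open>z = v\<close> in the inequality leaves, by
  \<open>norm_one_minus_cnj_mult\<close>, only |h v - v|^2 \<le> 0. Conversely, the inequality is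
  Schwarz-Pick with \<open>w = v = h v\<close>.\<close>

lemma julia_interior_iff:
  assumes holh: "h holomorphic_on ball 0 1" and maps: "h \<in> ball 0 1 \<rightarrow> ball 0 1"
    and v: "cmod v < 1"
  shows "julia h v \<longleftrightarrow> h v = v"
proof
  assume "julia h v"
  then have *: "(cmod (1 - cnj v * h v))\<^sup>2 * (1 - (cmod v)\<^sup>2) \<le> (cmod (1 - cnj v * v))\<^sup>2 * (1 - (cmod (h v))\<^sup>2)"
    using v by (simp add: julia_def)
  have "1 - cnj v * v = of_real (1 - (cmod v)\<^sup>2)"
    by (simp add: complex_norm_square mult.commute flip: of_real_power)
  then have "(cmod (1 - cnj v * v))\<^sup>2 = (1 - (cmod v)\<^sup>2)\<^sup>2"
    by (metis norm_of_real power2_abs)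
  with * have "(cmod (1 - cnj v * h v))\<^sup>2 * (1 - (cmod v)\<^sup>2) \<le> ((1 - (cmod v)\<^sup>2) * (1 - (cmod (h v))\<^sup>2)) * (1 - (cmod v)\<^sup>2)"
    by (simp only: power2_eq_square[of "1 - (cmod v)\<^sup>2"] mult_ac)
  then have "(cmod (1 - cnj v * h v))\<^sup>2 \<le> (1 - (cmod (h v))\<^sup>2) * (1 - (cmod v)\<^sup>2)"
    using one_minus_cmod_square_pos[OF v] by (simp add: mult.commute)
  with norm_one_minus_cnj_mult[of v "h v"] have "(cmod (h v - v))\<^sup>2 \<le> 0" by linarith
  then show "h v = v" by simp
next
  assume "h v = v"
  then have "(cmod (1 - cnj v * h z))\<^sup>2 * (1 - (cmod z)\<^sup>2) * (1 - (cmod v)\<^sup>2)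
    \<le> (cmod (1 - cnj v * z))\<^sup>2 * (1 - (cmod (h z))\<^sup>2) * (1 - (cmod v)\<^sup>2)" if "cmod z < 1" for z
    using Schwarz_Pick[OF holh maps v that] by simp
  then show "julia h v"
    using v one_minus_cmod_square_pos[OF v] by (auto simp: julia_def)
qed

lemma julia_limit:
  assumes v: "v \<longlonglongrightarrow> v0" and H: "\<And>z. cmod z < 1 \<Longrightarrow> (\<lambda>n. H n z) \<longlonglongrightarrow> h z"
    and J: "\<And>n::nat. julia (H n) (v n)"
  shows "julia h v0"
  unfolding julia_def
proof (intro conjI ballI)
  show "cmod v0 \<le> 1"
    using tendsto_norm[OF v] J by (auto intro!: LIMSEQ_le_const2 simp: julia_def)
  fix z :: complex
  assume z: "z \<in> ball 0 1"
  show "(cmod (1 - cnj v0 * h z))\<^sup>2 * (1 - (cmod z)\<^sup>2) \<le> (cmod (1 - cnj v0 * z))\<^sup>2 * (1 - (cmod (h z))\<^sup>2)"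
  proof (rule LIMSEQ_le)
    show "(\<lambda>n. (cmod (1 - cnj (v n) * H n z))\<^sup>2 * (1 - (cmod z)\<^sup>2)) \<longlonglongrightarrow> (cmod (1 - cnj v0 * h z))\<^sup>2 * (1 - (cmod z)\<^sup>2)"
      "(\<lambda>n. (cmod (1 - cnj (v n) * z))\<^sup>2 * (1 - (cmod (H n z))\<^sup>2)) \<longlonglongrightarrow> (cmod (1 - cnj v0 * z))\<^sup>2 * (1 - (cmod (h z))\<^sup>2)"
      using z v H by (auto intro!: tendsto_intros)
    show "\<exists>N. \<forall>n\<ge>N. (cmod (1 - cnj (v n) * H n z))\<^sup>2 * (1 - (cmod z)\<^sup>2) \<le> (cmod (1 - cnj (v n) * z))\<^sup>2 * (1 - (cmod (H n z))\<^sup>2)"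
      using J z by (auto simp: julia_def)
  qed
qed

text \<open>The contraction of \<open>h\<close> by a factor \<open>r n\<close> sends the closed disk
  of radius \<open>r n\<close> into itself, so Brouwer provides interior fixed points. They may
  drift to the circle as \<open>r n\<close> tends to 1, but the inequality survives at any limit
  point.\<close>

lemma julia_exists:
  assumes holh: "h holomorphic_on ball 0 1" and maps: "h \<in> ball 0 1 \<rightarrow> ball 0 1"
  shows "\<exists>v. julia h v"
proof -
  have h: "cmod (h z) < 1" if "cmod z < 1" for z
    using maps that by auto
  \<comment> \<open>The shift by 2 keeps \<open>r 0\<close> positive, as Brouwer's theorem on a ball
    of that radius requires.\<close>
  define r where "r n = 1 - 1 / real (n + 2)" for n
  have r: "0 < r n" "r n < 1" for n by (auto simp: r_def)
  have r_lim: "r \<longlonglongrightarrow> 1"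
    unfolding r_def by real_asymp
  have "\<exists>v. julia (\<lambda>z. of_real (r n) * h z) v" for n
  proof -
    have le: "cmod (of_real (r n) * h z) \<le> r n" if "cmod z < 1" for z
      using h[OF that] r[of n] by (simp add: norm_mult)
    have "continuous_on (cball 0 (r n)) (\<lambda>z. of_real (r n) * h z)"
      using r[of n] by (intro continuous_intros continuous_on_subset[OF holomorphic_on_imp_continuous_on[OF holh]]) auto
    moreover have "(\<lambda>z. of_real (r n) * h z) \<in> cball 0 (r n) \<rightarrow> cball 0 (r n)"
      using le r[of n] by auto
    ultimately obtain v where v: "v \<in> cball 0 (r n)" "of_real (r n) * h v = v"
      using brouwer_ball[OF r(1)] by metis
    have "julia (\<lambda>z. of_real (r n) * h z) v"
    proof (subst julia_interior_iff)
      show "(\<lambda>z. of_real (r n) * h z) holomorphic_on ball 0 1"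
        by (intro holomorphic_intros holh)
      show "(\<lambda>z. of_real (r n) * h z) \<in> ball 0 1 \<rightarrow> ball 0 1"
        using le r(2)[of n] by (force intro: le_less_trans)
      show "cmod v < 1" using v r[of n] by simp
    qed (use v in auto)
    then show ?thesis by blast
  qed
  then obtain v where J: "\<And>n. julia (\<lambda>z. of_real (r n) * h z) (v n)" by metis
  then have "\<forall>n. v n \<in> cball 0 1" by (auto simp: julia_def)
  then obtain l s where s: "strict_mono s" "(v \<circ> s) \<longlonglongrightarrow> l"
    using compact_cball[of "0::complex" 1] unfolding compact_def by metis
  have "julia h l"
  proof (rule julia_limit[OF s(2), where H="\<lambda>n z. of_real (r (s n)) * h z"])
    show "julia (\<lambda>z. of_real (r (s n)) * h z) ((v \<circ> s) n)" for n using J by simp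
    have "(\<lambda>n. r (s n)) \<longlonglongrightarrow> 1" using LIMSEQ_subseq_LIMSEQ[OF r_lim s(1)] by (simp add: o_def)
    then have "(\<lambda>n. of_real (r (s n)) * h z) \<longlonglongrightarrow> of_real 1 * h z" for z
      by (intro tendsto_intros)
    then show "(\<lambda>n. of_real (r (s n)) * h z) \<longlonglongrightarrow> h z" for z by simp
  qed
  then show ?thesis by blast
qed

text \<open>Supplies a premise of the identity theorem for uncountable sets of agreement that ends
  \<open>julia_unique\<close>.\<close>

lemma fsigma_ball:
  fixes a :: "'a::metric_space"
  shows "fsigma (ball a r)"
proof -
  have "ball a r = (\<Union>n. cball a (r - 1 / real (Suc n)))"
  proof (intro equalityI subsetI)
    fix x assume "x \<in> ball a r"
    then have "0 < r - dist a x" by simp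
    then obtain n where "inverse (real (Suc n)) < r - dist a x"
      using reals_Archimedean by blast
    then show "x \<in> (\<Union>n. cball a (r - 1 / real (Suc n)))"
      by (intro UN_I[of n]) (auto simp: inverse_eq_divide)
  next
    fix x assume "x \<in> (\<Union>n. cball a (r - 1 / real (Suc n)))"
    then obtain n where "dist a x \<le> r - 1 / real (Suc n)" by auto
    moreover have "0 < 1 / real (Suc n)" by simp
    ultimately show "x \<in> ball a r" unfolding mem_ball by linarith
  qed
  then show ?thesis by (simp add: fsigma.intros)
qed

text \<open>For \<open>0 < t < 1\<close> the convex combination of the two gauges \<open>\<bar>1 - cnj v z\<bar>\<^sup>2 / (1 - \<bar>z\<bar>\<^sup>2)\<close>
  and \<open>\<bar>1 - cnj w z\<bar>\<^sup>2 / (1 - \<bar>z\<bar>\<^sup>2)\<close> has a unique minimum \<open>m t\<close>, attained at \<open>p t\<close>, and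
  \<open>h\<close> cannot increase it.  So \<open>h\<close> fixes a whole path from \<open>w\<close> to \<open>v\<close>.\<close>

lemma julia_unique:
  assumes holh: "h holomorphic_on ball 0 1" and maps: "h \<in> ball 0 1 \<rightarrow> ball 0 1"
    and v: "julia h v" and w: "julia h w" and "v \<noteq> w" and z: "cmod z < 1"
  shows "h z = z"
proof -
  \<comment> \<open>\<open>c\<close> and \<open>B\<close> are the means of the two points and of
    their squared moduli with weights \<open>t\<close> and \<open>1 - t\<close>. \<open>D\<close> is
    the variance, whence |c t|^2 = B t - D t.\<close>
  define c where "c t = of_real t * v + of_real (1 - t) * w" for t :: real
  define B where "B t = t * (cmod v)\<^sup>2 + (1 - t) * (cmod w)\<^sup>2" for t :: real
  define D where "D t = t * (1 - t) * (cmod (v - w))\<^sup>2" for t :: real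
  \<comment> \<open>The nonnegative root of m^2 - (1 - B) m - D = 0. For this \<open>m\<close>,
    subtracting m (1 - |x|^2) from the weighted mean of |1 - cnj v x|^2 and |1 - cnj w x|^2 leaves a
    multiple of the perfect square |x - p|^2.\<close>
  define m where "m t = ((1 - B t) + sqrt ((1 - B t)\<^sup>2 + 4 * D t)) / 2" for t
  define p where "p t = c t / of_real (B t + m t)" for t
  have vw: "(cmod v)\<^sup>2 \<le> 1" "(cmod w)\<^sup>2 \<le> 1"
    using v w by (auto simp: julia_def abs_square_le_1)
  have c_norm: "(cmod (c t))\<^sup>2 = B t - D t" for t
    unfolding c_def B_def D_def cmod_power2
    by (cases v; cases w) (simp add: power2_eq_square algebra_simps)
  have B_le: "B t \<le> 1" if "t \<in> {0..1}" for t
    unfolding B_def using convex_bound_le[of "(cmod v)\<^sup>2" 1 "(cmod w)\<^sup>2" t "1 - t"] vw that by simp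
  have D_ge: "0 \<le> D t" if "t \<in> {0..1}" for t
    using that by (simp add: D_def)
  have Bm: "1 \<le> B t + m t" if "t \<in> {0..1}" for t
  proof -
    have "sqrt ((1 - B t)\<^sup>2) \<le> sqrt ((1 - B t)\<^sup>2 + 4 * D t)"
      using D_ge[OF that] by (intro real_sqrt_le_mono) auto
    then show ?thesis using B_le[OF that] by (simp add: m_def field_simps)
  qed
  have m_eq: "(1 - m t) * (B t + m t) = (cmod (c t))\<^sup>2" if "t \<in> {0..1}" for t
  proof -
    have "2 * m t - (1 - B t) = sqrt ((1 - B t)\<^sup>2 + 4 * D t)"
      by (simp add: m_def field_simps)
    then have "(2 * m t - (1 - B t))\<^sup>2 = (1 - B t)\<^sup>2 + 4 * D t"
      using D_ge[OF that] by simp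
    then show ?thesis unfolding c_norm by (simp add: power2_eq_square algebra_simps)
  qed
  have fixed: "p t \<in> ball 0 1 \<and> h (p t) = p t" if t: "t \<in> {0<..<1}" for t
  proof -
    have t': "t \<in> {0..1}" using t by auto
    have pos: "B t + m t > 0" using Bm[OF t'] by simp
    \<comment> \<open>Strict positivity of the variance puts \<open>p t\<close> strictly inside the
      disk: it gives 1 - m < B + m, while (1 - m) (B + m) = |c|^2.\<close>
    have "D t > 0" using t \<open>v \<noteq> w\<close> by (simp add: D_def)
    then have "0 < sqrt ((1 - B t)\<^sup>2 + 4 * D t)"
      by (simp add: add_nonneg_pos)
    then have "1 - m t < B t + m t"
      by (simp add: m_def field_simps)
    then have "(cmod (c t))\<^sup>2 < (B t + m t)\<^sup>2"
      using m_eq[OF t'] pos by (metis mult_strict_right_mono power2_eq_square)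
    then have "cmod (c t) < B t + m t"
      using pos by (meson less_imp_le power_less_imp_less_base)
    then have p1: "cmod (p t) < 1"
      using pos by (simp add: p_def norm_divide del: of_real_add)
    \<comment> \<open>Completing the square. After division by 1 - |x|^2 this exhibits the minimum
      \<open>m t\<close> and its only minimiser \<open>p t\<close>.\<close>
    have N: "t * (cmod (1 - cnj v * x))\<^sup>2 + (1 - t) * (cmod (1 - cnj w * x))\<^sup>2
        = m t * (1 - (cmod x)\<^sup>2) + (B t + m t) * (cmod (x - p t))\<^sup>2" for x
    proof -
      have c: "c t = of_real (B t + m t) * p t" using pos by (simp add: p_def del: of_real_add)
      have "t * (cmod (1 - cnj v * x))\<^sup>2 + (1 - t) * (cmod (1 - cnj w * x))\<^sup>2
          = 1 - 2 * Re (cnj (c t) * x) + B t * (cmod x)\<^sup>2"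
        unfolding B_def c_def cmod_power2
        by (cases v; cases w; cases x) (simp add: power2_eq_square algebra_simps)
      moreover have "1 - m t = (B t + m t) * (cmod (p t))\<^sup>2"
        using m_eq[OF t'] pos by (simp add: c norm_mult power2_eq_square del: of_real_add)
      moreover have "(cmod (x - p t))\<^sup>2 = (cmod x)\<^sup>2 - 2 * Re (cnj (p t) * x) + (cmod (p t))\<^sup>2"
        unfolding cmod_power2 by (cases x; cases "p t") (simp add: power2_eq_square algebra_simps)
      moreover have "Re (cnj (c t) * x) = (B t + m t) * Re (cnj (p t) * x)"
        unfolding c by (simp add: algebra_simps)
      moreover have "1 - 2 * R + b * X = m * (1 - X) + (b + m) * (X - 2 * P + Q)"
        if "R = (b + m) * P" "1 - m = (b + m) * Q" for R b X m P Q :: real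
        using that by algebra
      ultimately show ?thesis by presburger
    qed
    let ?x = "h (p t)"
    have "(t * (cmod (1 - cnj v * ?x))\<^sup>2 + (1 - t) * (cmod (1 - cnj w * ?x))\<^sup>2) * (1 - (cmod (p t))\<^sup>2)
      = t * ((cmod (1 - cnj v * ?x))\<^sup>2 * (1 - (cmod (p t))\<^sup>2)) + (1 - t) * ((cmod (1 - cnj w * ?x))\<^sup>2 * (1 - (cmod (p t))\<^sup>2))"
      by (simp add: algebra_simps)
    also have "\<dots> \<le> t * ((cmod (1 - cnj v * p t))\<^sup>2 * (1 - (cmod ?x)\<^sup>2)) + (1 - t) * ((cmod (1 - cnj w * p t))\<^sup>2 * (1 - (cmod ?x)\<^sup>2))"
      using v w p1 t by (intro add_mono mult_left_mono) (auto simp: julia_def)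
    also have "\<dots> = (t * (cmod (1 - cnj v * p t))\<^sup>2 + (1 - t) * (cmod (1 - cnj w * p t))\<^sup>2) * (1 - (cmod ?x)\<^sup>2)"
      by (simp add: algebra_simps)
    \<comment> \<open>By \<open>N\<close> at \<open>h (p t)\<close> on the left and at
      \<open>p t\<close> on the right, the terms with the factor \<open>m t\<close> cancel and only
      the square at \<open>h (p t)\<close> survives.\<close>
    finally have "(B t + m t) * (cmod (?x - p t))\<^sup>2 * (1 - (cmod (p t))\<^sup>2) \<le> 0"
      unfolding N by (simp add: algebra_simps)
    then have "?x = p t"
      using pos one_minus_cmod_square_pos[OF p1] by (simp add: mult_le_0_iff)
    then show ?thesis using p1 by simp
  qed
  have "continuous_on {0..1} p"
    unfolding p_def using Bm by (force intro!: continuous_intros simp: B_def c_def m_def D_def simp flip: of_real_add)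
  then have "connected (p ` {0..1})"
    by (intro connected_continuous_image) auto
  moreover have "p 0 = w" "p 1 = v"
    using vw by (auto simp: p_def c_def B_def m_def D_def diff_divide_distrib simp flip: of_real_add)
  moreover have "p 0 \<in> p ` {0..1}" "p 1 \<in> p ` {0..1}" by auto
  \<comment> \<open>A connected set with two distinct points is uncountable. The endpoints are
    removed afterwards because \<open>fixed\<close> covers only 0 < t < 1.\<close>
  ultimately have "uncountable (p ` {0..1})"
    using connected_uncountable \<open>v \<noteq> w\<close> by metis
  then have "uncountable (p ` {0..1} - {p 0, p 1})"
    by (intro uncountable_minus_countable) auto
  moreover have "p ` {0..1} - {p 0, p 1} \<subseteq> {z \<in> ball 0 1. h z = z}"
  proof
    fix x assume "x \<in> p ` {0..1} - {p 0, p 1}"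
    then obtain t where "t \<in> {0..1}" "x = p t" "t \<noteq> 0" "t \<noteq> 1" by force
    then have "t \<in> {0<..<1}" by auto
    from fixed[OF this] \<open>x = p t\<close> show "x \<in> {z \<in> ball 0 1. h z = z}" by simp
  qed
  ultimately have "uncountable {z \<in> ball 0 1. h z = z}"
    using countable_subset by blast
  then have "ball 0 1 \<subseteq> {z \<in> ball 0 1. h z = z}"
    by (intro holomorphic_countable_equal holh) (auto intro: fsigma_ball)
  then show ?thesis using z by auto
qed


section \<open>The Julia-Caratheodory theorem\<close>

text \<open>Schwarz-Pick for maps into the right half-plane, transported by the Cayley transform
  \<open>q\<close>. This lands in the open disk when the real part is positive; the closed
  half-plane follows by adding \<open>e\<close> and letting \<open>e\<close> tend to 0.\<close>

lemma half_plane_Schwarz_Pick: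
  assumes holG: "G holomorphic_on ball 0 1" and G: "\<And>z. cmod z < 1 \<Longrightarrow> Re (G z) \<ge> 0"
    and w: "cmod w < 1" and z: "cmod z < 1"
  shows "(cmod (G z + cnj (G w)))\<^sup>2 * (1 - (cmod z)\<^sup>2) * (1 - (cmod w)\<^sup>2)
    \<le> 4 * (cmod (1 - cnj w * z))\<^sup>2 * Re (G z) * Re (G w)"
proof -
  have pos: "(cmod (H z + cnj (H w)))\<^sup>2 * (1 - (cmod z)\<^sup>2) * (1 - (cmod w)\<^sup>2)
    \<le> 4 * (cmod (1 - cnj w * z))\<^sup>2 * Re (H z) * Re (H w)"
    if holH: "H holomorphic_on ball 0 1" and H: "\<And>z. cmod z < 1 \<Longrightarrow> Re (H z) > 0" for H
  proof -
    define q where "q x = (H x - 1) / (H x + 1)" for x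
    have nz: "H x + 1 \<noteq> 0" if "cmod x < 1" for x
      using H[OF that] by (auto simp: complex_eq_iff)
    have q1: "1 - (cmod (q x))\<^sup>2 = 4 * Re (H x) / (cmod (H x + 1))\<^sup>2" if "cmod x < 1" for x
    proof -
      have "(cmod (H x + 1))\<^sup>2 - (cmod (H x - 1))\<^sup>2 = 4 * Re (H x)"
        unfolding cmod_power2 by (simp add: power2_eq_square algebra_simps)
      then show ?thesis
        using nz[OF that] by (simp add: q_def norm_divide power_divide flip: diff_divide_distrib) (simp add: divide_simps)
    qed
    have "q x \<in> ball 0 1" if "x \<in> ball 0 1" for x
    proof -
      have "(cmod (q x))\<^sup>2 < 1"
        using q1[of x] H[of x] nz[of x] that
        by (smt (verit, best) divide_pos_pos mem_ball_0 norm_eq_zero zero_less_power2)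
      then show ?thesis by (simp add: abs_square_less_1)
    qed
    then have "q \<in> ball 0 1 \<rightarrow> ball 0 1" by auto
    moreover have "q holomorphic_on ball 0 1"
      unfolding q_def using nz by (intro holomorphic_intros holH) auto
    ultimately have "(cmod (1 - cnj (q w) * q z))\<^sup>2 * (1 - (cmod z)\<^sup>2) * (1 - (cmod w)\<^sup>2)
      \<le> (cmod (1 - cnj w * z))\<^sup>2 * (1 - (cmod (q z))\<^sup>2) * (1 - (cmod (q w))\<^sup>2)"
      using Schwarz_Pick w z by blast
    moreover have "1 - cnj (q w) * q z = 2 * (H z + cnj (H w)) / ((H z + 1) * cnj (H w + 1))"
    proof -
      have "cnj (H w + 1) \<noteq> 0" using nz[OF w] by (metis complex_cnj_zero_iff)
      moreover have "1 - (b - 2) / b * ((a - 2) / a) = 2 * (a + b - 2) / (a * b)" if "a \<noteq> 0" "b \<noteq> 0" for a b :: complex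
        using that by (simp add: divide_simps) (simp add: algebra_simps)
      from this[OF nz[OF z] calculation] show ?thesis
        by (simp add: q_def add.commute)
    qed
    then have "(cmod (1 - cnj (q w) * q z))\<^sup>2 = 4 * (cmod (H z + cnj (H w)))\<^sup>2 / ((cmod (H z + 1))\<^sup>2 * (cmod (H w + 1))\<^sup>2)"
      by (simp only: norm_divide norm_mult complex_mod_cnj power_divide power_mult_distrib) simp
    ultimately have "4 * (cmod (H z + cnj (H w)))\<^sup>2 / ((cmod (H z + 1))\<^sup>2 * (cmod (H w + 1))\<^sup>2) * (1 - (cmod z)\<^sup>2) * (1 - (cmod w)\<^sup>2)
      \<le> (cmod (1 - cnj w * z))\<^sup>2 * (4 * Re (H z) / (cmod (H z + 1))\<^sup>2) * (4 * Re (H w) / (cmod (H w + 1))\<^sup>2)"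
      using q1 w z by simp
    moreover have "X * Z * W \<le> 4 * Y * a * b"
      if "4 * X / (P * Q) * Z * W \<le> Y * (4 * a / P) * (4 * b / Q)" "P > 0" "Q > 0" for X Y Z W P Q a b :: real
    proof -
      have "4 / (P * Q) * (X * Z * W) \<le> 4 / (P * Q) * (4 * Y * a * b)"
        using that(1) by (simp add: mult_ac)
      then show ?thesis
        using that(2,3) by (subst (asm) mult_le_cancel_left_pos) auto
    qed
    ultimately show ?thesis
      using nz[OF z] nz[OF w] by simp
  qed
  have e: "(cmod (G z + of_real e + cnj (G w + of_real e)))\<^sup>2 * (1 - (cmod z)\<^sup>2) * (1 - (cmod w)\<^sup>2)
    \<le> 4 * (cmod (1 - cnj w * z))\<^sup>2 * Re (G z + of_real e) * Re (G w + of_real e)" if "e > 0" for e :: real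
    using that G by (intro pos holomorphic_intros holG) (auto intro: add_nonneg_pos)
  show ?thesis
  proof (rule tendsto_le[of "at_right (0::real)"])
    show "((\<lambda>e. 4 * (cmod (1 - cnj w * z))\<^sup>2 * Re (G z + of_real e) * Re (G w + of_real e)) \<longlongrightarrow>
      4 * (cmod (1 - cnj w * z))\<^sup>2 * Re (G z) * Re (G w)) (at_right 0)"
      by (auto intro!: tendsto_eq_intros)
    show "((\<lambda>e. (cmod (G z + of_real e + cnj (G w + of_real e)))\<^sup>2 * (1 - (cmod z)\<^sup>2) * (1 - (cmod w)\<^sup>2)) \<longlongrightarrow>
      (cmod (G z + cnj (G w)))\<^sup>2 * (1 - (cmod z)\<^sup>2) * (1 - (cmod w)\<^sup>2)) (at_right 0)"
      by (auto intro!: tendsto_eq_intros)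
    show "\<forall>\<^sub>F d in at_right 0. (cmod (G z + of_real d + cnj (G w + of_real d)))\<^sup>2 * (1 - (cmod z)\<^sup>2) * (1 - (cmod w)\<^sup>2)
      \<le> 4 * (cmod (1 - cnj w * z))\<^sup>2 * Re (G z + of_real d) * Re (G w + of_real d)"
      using e by (intro eventually_at_rightI[of 0 1]) auto
  qed simp
qed

text \<open>The right side is the Poisson kernel at \<open>v\<close>, the reciprocal of the horodisk
  gauge. Julia's inequality at a point of the circle thus becomes a comparison of real parts of
  Cayley transforms.\<close>

lemma Re_Cayley:
  assumes "cmod v = 1" "x \<noteq> v"
  shows "Re ((v + x) / (v - x)) = (1 - (cmod x)\<^sup>2) / (cmod (v - x))\<^sup>2"
proof -
  have "(v + x) / (v - x) = ((v + x) * cnj (v - x)) / of_real ((cmod (v - x))\<^sup>2)"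
    using complex_div_cnj[of "v + x" "v - x"] by simp
  moreover have "Re ((v + x) * cnj (v - x)) = (cmod v)\<^sup>2 - (cmod x)\<^sup>2"
    unfolding cmod_power2 by (simp add: power2_eq_square algebra_simps)
  ultimately show ?thesis using assms by (simp only: Re_divide_of_real) simp
qed

lemma norm_one_minus_cnj_mult_unit:
  assumes "cmod v = 1"
  shows "cmod (1 - cnj v * x) = cmod (v - x)"
proof -
  have "v * cnj v = 1" using assms by (simp add: complex_norm_square[symmetric])
  then have "v - x = v * (1 - cnj v * x)" by (simp add: algebra_simps)
  then show ?thesis using assms by (simp add: norm_mult)
qed

text \<open>Compare \<open>z\<close> with one fixed \<open>w\<close> at which Re G is small relative
  to the Poisson kernel. For \<open>z\<close> near \<open>v\<close> in the Stolz angle, Schwarz-Pick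
  gives (|G z| - |G w|)^2 |v - z| \<le> 8 M \<epsilon> |G z|. Either |G z| is below 2 |G w| and the
  factor v - z makes the product small, or |G z| |v - z| is at most 32 M \<epsilon>.\<close>

lemma Julia_Caratheodory_aux:
  fixes G :: "complex \<Rightarrow> complex"
  assumes holG: "G holomorphic_on ball 0 1" and G: "\<And>z. cmod z < 1 \<Longrightarrow> Re (G z) \<ge> 0"
    and v: "cmod v = 1" and M: "M > 1"
    and small: "\<And>e. e > 0 \<Longrightarrow> \<exists>w. cmod w < 1 \<and> Re (G w) \<le> e * ((1 - (cmod w)\<^sup>2) / (cmod (v - w))\<^sup>2)"
  shows "((\<lambda>z. G z * (v - z)) \<longlongrightarrow> 0) (at v within stolz_angle v M)"
proof (rule tendstoI)
  fix e :: real assume "e > 0"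
  \<comment> \<open>The final bound is \<open>32 * M * \<epsilon>\<close>: 8 from Schwarz-Pick,
    \<open>M\<close> from the Stolz angle and 4 from squaring \<open>a / 2\<close>. This choice
    makes it \<open>e / 2\<close>.\<close>
  define \<epsilon> where "\<epsilon> = e / (64 * M)"
  have eps: "\<epsilon> > 0" "32 * M * \<epsilon> < e" using \<open>e > 0\<close> M by (auto simp: \<epsilon>_def)
  obtain w where w: "cmod w < 1" "Re (G w) \<le> \<epsilon> * ((1 - (cmod w)\<^sup>2) / (cmod (v - w))\<^sup>2)"
    using small[OF eps(1)] by blast
  define b where "b = cmod (G w)"
  have vw: "(cmod (v - w))\<^sup>2 > 0" using v w by auto
  have 1: "\<forall>\<^sub>F z in at v within stolz_angle v M. (cmod (1 - cnj w * z))\<^sup>2 < 2 * (cmod (v - w))\<^sup>2"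
  proof (rule order_tendstoD(2))
    have "cmod (1 - cnj w * v) = cmod (v - w)"
      using norm_one_minus_cnj_mult_unit[OF v, of w] by (metis complex_cnj_cnj complex_cnj_diff complex_cnj_mult complex_cnj_one complex_mod_cnj mult.commute)
    then show "((\<lambda>z. (cmod (1 - cnj w * z))\<^sup>2) \<longlongrightarrow> (cmod (v - w))\<^sup>2) (at v within stolz_angle v M)"
      by (auto intro!: tendsto_eq_intros)
  qed (use vw in auto)
  have 2: "\<forall>\<^sub>F z in at v within stolz_angle v M. 2 * b * cmod (v - z) < e"
    using \<open>e > 0\<close> by (intro order_tendstoD(2)[of _ 0]) (auto intro!: tendsto_eq_intros)
  have 3: "\<forall>\<^sub>F z in at v within stolz_angle v M. z \<in> stolz_angle v M"
    by (simp add: eventually_at_filter)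
  show "\<forall>\<^sub>F z in at v within stolz_angle v M. dist (G z * (v - z)) 0 < e"
    using 1 2 3
  proof eventually_elim
    case (elim z)
    then have z: "cmod z < 1" and st: "cmod (v - z) < M * (1 - cmod z)"
      by (auto simp: stolz_angle_def norm_minus_commute)
    define a where "a = cmod (G z)"
    have pz: "0 < 1 - (cmod z)\<^sup>2" and pw: "0 < 1 - (cmod w)\<^sup>2"
      using one_minus_cmod_square_pos w z by auto
    have "\<bar>a - b\<bar> \<le> cmod (G z + cnj (G w))"
      unfolding a_def b_def using norm_triangle_ineq3[of "G z" "- cnj (G w)"] by simp
    then have "(a - b)\<^sup>2 \<le> (cmod (G z + cnj (G w)))\<^sup>2"
      by (metis abs_ge_zero power2_abs power_mono)
    then have "(a - b)\<^sup>2 * (1 - (cmod z)\<^sup>2) * (1 - (cmod w)\<^sup>2) \<le> (cmod (G z + cnj (G w)))\<^sup>2 * (1 - (cmod z)\<^sup>2) * (1 - (cmod w)\<^sup>2)"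
      using pz pw by (intro mult_right_mono) auto
    also have "\<dots> \<le> 4 * (cmod (1 - cnj w * z))\<^sup>2 * Re (G z) * Re (G w)"
      by (rule half_plane_Schwarz_Pick[OF holG G w(1) z])
    also have "\<dots> \<le> 4 * (2 * (cmod (v - w))\<^sup>2) * a * (\<epsilon> * ((1 - (cmod w)\<^sup>2) / (cmod (v - w))\<^sup>2))"
      using elim(1) w G z eps pw complex_Re_le_cmod[of "G z"] unfolding a_def
      by (intro mult_mono) auto
    also have "\<dots> = (8 * \<epsilon> * a) * (1 - (cmod w)\<^sup>2)"
      using vw by simp
    finally have "(a - b)\<^sup>2 * (1 - (cmod z)\<^sup>2) \<le> 8 * \<epsilon> * a"
      using pw by simp
    moreover have "cmod (v - z) \<le> M * (1 - (cmod z)\<^sup>2)"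
    proof -
      have "(cmod z)\<^sup>2 \<le> cmod z" using z by (simp add: power2_eq_square mult_left_le)
      then have "M * (1 - cmod z) \<le> M * (1 - (cmod z)\<^sup>2)" using M by simp
      then show ?thesis using st by simp
    qed
    ultimately have "(a - b)\<^sup>2 * cmod (v - z) \<le> M * (8 * \<epsilon> * a)"
      using M by (smt (verit) mult.assoc mult.left_commute mult_left_mono zero_le_power2)
    moreover have "(a / 2)\<^sup>2 * cmod (v - z) \<le> (a - b)\<^sup>2 * cmod (v - z)" if "2 * b \<le> a"
      using that by (intro mult_right_mono power_mono) (auto simp: a_def)
    ultimately have "a * (a * cmod (v - z)) \<le> a * (32 * M * \<epsilon>)" if "2 * b \<le> a"
      using that by (force simp: power2_eq_square field_simps)
    then have "a * cmod (v - z) < e"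
      using elim(2) eps \<open>e > 0\<close> mult_right_mono[of a "2 * b" "cmod (v - z)"]
      by (cases "2 * b \<le> a"; cases "a = 0") (auto simp: a_def)
    then show ?case by (simp add: a_def norm_mult)
  qed
qed

text \<open>After Cayley transforms, Julia's inequality says Re F \<ge> Re u. Subtracting the
  largest multiple of \<open>u\<close> that keeps the real part nonnegative leaves \<open>G\<close>,
  which is negligible against \<open>u\<close> in Stolz angles by the previous lemma. So F behaves
  like c u, that is, h z - v like (z - v) / c.\<close>

lemma Julia_Caratheodory:
  assumes holh: "h holomorphic_on ball 0 1" and maps: "h \<in> ball 0 1 \<rightarrow> ball 0 1"
    and J: "julia h v" and v: "cmod v = 1"
  shows "\<exists>c::real. c \<le> 1 \<and> nontangential_limit (\<lambda>z. (h z - v) / (z - v)) v (of_real c)"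
proof -
  define u where "u z = (v + z) / (v - z)" for z
  define F where "F z = (v + h z) / (v - h z)" for z
  define R where "R z = (1 - (cmod z)\<^sup>2) / (cmod (v - z))\<^sup>2" for z
  have h: "cmod (h z) < 1" if "cmod z < 1" for z
    using maps that by auto
  have ne: "z \<noteq> v" "h z \<noteq> v" if "cmod z < 1" for z
    using v that h[OF that] by auto
  have Re_u: "Re (u z) = R z" and R_pos: "R z > 0" if "cmod z < 1" for z
    using Re_Cayley[OF v] ne(1)[OF that] one_minus_cmod_square_pos[OF that] by (auto simp: u_def R_def intro!: divide_pos_pos)
  have Re_F: "R z \<le> Re (F z)" if "cmod z < 1" for z
  proof -
    have "(cmod (v - h z))\<^sup>2 * (1 - (cmod z)\<^sup>2) \<le> (cmod (v - z))\<^sup>2 * (1 - (cmod (h z))\<^sup>2)"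
      using J that by (auto simp: julia_def norm_one_minus_cnj_mult_unit[OF v])
    moreover have "Re (F z) = (1 - (cmod (h z))\<^sup>2) / (cmod (v - h z))\<^sup>2"
      unfolding F_def by (rule Re_Cayley[OF v ne(2)[OF that]])
    ultimately show ?thesis
      using ne[OF that] by (simp add: R_def frac_le_eq divide_le_0_iff mult.commute)
  qed
  \<comment> \<open>The angular derivative will be \<open>1 / c\<close>.\<close>
  define c where "c = Inf ((\<lambda>z. Re (F z) / R z) ` ball 0 1)"
  have bdd: "1 \<le> Re (F z) / R z" if "cmod z < 1" for z
    using Re_F[OF that] R_pos[OF that] by simp
  then have "bdd_below ((\<lambda>z. Re (F z) / R z) ` ball 0 1)"
    by (intro bdd_belowI[of _ 1]) auto
  then have c_le: "c * R z \<le> Re (F z)" if "cmod z < 1" for z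
    using cINF_lower[of "\<lambda>z. Re (F z) / R z" "ball 0 1" z] R_pos[OF that] that by (simp add: c_def field_simps)
  \<comment> \<open>Here Julia's inequality yields the bound 1 on the angular derivative.\<close>
  have c1: "1 \<le> c"
    unfolding c_def using bdd by (intro cINF_greatest) auto
  define G where "G z = F z - of_real c * u z" for z
  have lim_G: "((\<lambda>z. G z * (v - z)) \<longlongrightarrow> 0) (at v within stolz_angle v M)" if "M > 1" for M
  proof (rule Julia_Caratheodory_aux[OF _ _ v that])
    show "G holomorphic_on ball 0 1"
      unfolding G_def F_def u_def using ne by (intro holomorphic_intros holh) auto
    show "Re (G z) \<ge> 0" if "cmod z < 1" for z
      using c_le[OF that] Re_u[OF that] by (simp add: G_def)
    fix e :: real assume "e > 0"
    then obtain w where w: "w \<in> ball 0 1" "Re (F w) / R w < c + e"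
      using cInf_lessD[of "(\<lambda>z. Re (F z) / R z) ` ball 0 1" "c + e"] by (auto simp: c_def)
    then have "Re (G w) \<le> e * R w"
      using R_pos[of w] Re_u[of w] by (simp add: G_def field_simps)
    then show "\<exists>w. cmod w < 1 \<and> Re (G w) \<le> e * ((1 - (cmod w)\<^sup>2) / (cmod (v - w))\<^sup>2)"
      using w by (auto simp: R_def)
  qed
  have "((\<lambda>z. (h z - v) / (z - v)) \<longlongrightarrow> of_real (1 / c)) (at v within stolz_angle v M)" if "M > 1" for M
  proof -
    have "((\<lambda>z. 2 * v / (G z * (v - z) + of_real c * (v + z) + (v - z))) \<longlongrightarrow>
        2 * v / (0 + of_real c * (v + v) + (v - v))) (at v within stolz_angle v M)"
      using c1 v by (intro tendsto_intros lim_G[OF that]) (auto simp flip: mult_2)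
    moreover have "2 * v / (0 + of_real c * (v + v) + (v - v)) = of_real (1 / c)"
      using c1 v by (auto simp: field_simps)
    \<comment> \<open>The Cayley transform is undone by
      \<open>v - h z = 2 * v / (F z + 1)\<close>.\<close>
    moreover have "2 * v / (G z * (v - z) + of_real c * (v + z) + (v - z)) = (h z - v) / (z - v)" if "z \<in> stolz_angle v M" for z
    proof -
      have z: "cmod z < 1" using that by (simp add: stolz_angle_def)
      have ne': "v - z \<noteq> 0" "v - h z \<noteq> 0" "v \<noteq> 0" using ne[OF z] v by auto
      have "u z * (v - z) = v + z" using ne' by (simp add: u_def)
      then have eq: "G z * (v - z) + of_real c * (v + z) + (v - z) = (F z + 1) * (v - z)"
        by (simp add: G_def algebra_simps)
      have "F z + 1 = 2 * v / (v - h z)"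
        using ne' by (simp add: F_def field_simps)
      then have "2 * v / ((F z + 1) * (v - z)) = (v - h z) / (v - z)"
        using ne' by simp
      moreover have "(h z - v) / (z - v) = (v - h z) / (v - z)"
        by (metis minus_diff_eq minus_divide_divide)
      ultimately show ?thesis unfolding eq by simp
    qed
    ultimately show ?thesis
      by (metis (no_types, lifting) Lim_cong_within)
  qed
  then show ?thesis
    using c1 by (intro exI[of _ "1 / c"]) (auto simp: nontangential_limit_def)
qed

text \<open>Apply Schwarz-Pick to \<open>z\<close> and the radial points \<open>x n\<close>, and
  divide by 1 - r n. The ratio (1 - |h (x n)|) / (1 - r n) is at most the modulus of the difference
  quotient, which tends to |c|.\<close>

lemma denjoy_wolff_imp_julia:
  assumes holh: "h holomorphic_on ball 0 1" and maps: "h \<in> ball 0 1 \<rightarrow> ball 0 1"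
    and v: "cmod v = 1" and lim_h: "nontangential_limit h v v"
    and lim: "nontangential_limit (\<lambda>z. (h z - v) / (z - v)) v (of_real c)" and c: "c \<le> 1"
  shows "julia h v"
proof -
  have h: "cmod (h z) < 1" if "cmod z < 1" for z
    using maps that by auto
  define r where "r n = 1 - 1 / real (n + 2)" for n
  have r: "0 < r n" "r n < 1" for n by (auto simp: r_def)
  have r_lim: "r \<longlonglongrightarrow> 1"
    unfolding r_def by real_asymp
  define x where "x n = of_real (r n) * v" for n
  have nx: "cmod (x n) = r n" for n using v r by (simp add: x_def norm_mult less_imp_le)
  have xv: "cmod (x n - v) = 1 - r n" for n
  proof -
    have "x n - v = - (of_real (1 - r n) * v)" by (simp add: x_def algebra_simps)
    then show ?thesis using r[of n] v by (simp only: norm_minus_cancel norm_mult norm_of_real) simp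
  qed
  \<comment> \<open>On the radius |x n - v| = 1 - |x n|, so every Stolz angle with aperture above 1
    contains these points; 2 is one choice.\<close>
  have x_lim: "filterlim x (at v within stolz_angle v 2) sequentially"
    unfolding filterlim_at
  proof
    have "x \<longlonglongrightarrow> of_real 1 * v" unfolding x_def by (intro tendsto_intros r_lim)
    then show "x \<longlonglongrightarrow> v" by simp
    show "\<forall>\<^sub>F n in sequentially. x n \<in> stolz_angle v 2 \<and> x n \<noteq> v"
    proof (intro always_eventually allI)
      fix n
      have "x n \<noteq> v" using nx[of n] r[of n] v by auto
      then show "x n \<in> stolz_angle v 2 \<and> x n \<noteq> v"
        using r[of n] by (simp add: stolz_angle_def nx xv)
    qed
  qed
  have h_lim: "(\<lambda>n. h (x n)) \<longlonglongrightarrow> v"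
    by (rule filterlim_compose[OF _ x_lim]) (use lim_h in \<open>auto simp: nontangential_limit_def\<close>)
  have q_lim: "(\<lambda>n. (h (x n) - v) / (x n - v)) \<longlonglongrightarrow> of_real c"
    by (rule filterlim_compose[OF _ x_lim]) (use lim in \<open>auto simp: nontangential_limit_def\<close>)
  \<comment> \<open>On the radius the difference quotient is (1 - cnj v h) / (1 - r), with
    nonnegative real part. Hence c \<ge> 0, so that c \<le> 1 also bounds the modulus |c| in the
    estimate below.\<close>
  have "0 \<le> Re ((h (x n) - v) / (x n - v))" for n
  proof -
    have vv: "v * cnj v = 1" using v by (simp add: complex_norm_square[symmetric])
    have "x n - v = - (of_real (1 - r n) * v)" by (simp add: x_def algebra_simps)
    moreover have "h (x n) - v = - ((1 - cnj v * h (x n)) * v)"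
      using vv by (simp add: algebra_simps)
    ultimately have "(h (x n) - v) / (x n - v) = (1 - cnj v * h (x n)) / of_real (1 - r n)"
      using v by (simp only: minus_divide_divide) auto
    moreover have "Re (cnj v * h (x n)) \<le> 1"
      using complex_Re_le_cmod[of "cnj v * h (x n)"] h[of "x n"] nx[of n] r[of n] v by (simp add: norm_mult)
    ultimately show ?thesis using r[of n] by (simp only: Re_divide_of_real) simp
  qed
  then have "0 \<le> c"
    using tendsto_Re[OF q_lim] by (auto intro: LIMSEQ_le_const)
  show ?thesis
    unfolding julia_def
  proof (intro conjI ballI)
    show "cmod v \<le> 1" using v by simp
    fix z :: complex assume "z \<in> ball 0 1"
    then have z: "cmod z < 1" by simp
    let ?L = "\<lambda>n. (cmod (1 - cnj (h (x n)) * h z))\<^sup>2 * (1 - (cmod z)\<^sup>2) * (1 + r n)"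
    let ?R = "\<lambda>n. (cmod (1 - cnj (x n) * z))\<^sup>2 * (1 - (cmod (h z))\<^sup>2) * ((1 + cmod (h (x n))) * cmod ((h (x n) - v) / (x n - v)))"
    have "?L n \<le> ?R n" for n
    proof -
      have "?L n * (1 - r n) = (cmod (1 - cnj (h (x n)) * h z))\<^sup>2 * (1 - (cmod z)\<^sup>2) * (1 - (cmod (x n))\<^sup>2)"
        by (simp add: nx power2_eq_square algebra_simps)
      also have "\<dots> \<le> (cmod (1 - cnj (x n) * z))\<^sup>2 * (1 - (cmod (h z))\<^sup>2) * (1 - (cmod (h (x n)))\<^sup>2)"
        using Schwarz_Pick[OF holh maps _ z, of "x n"] nx r by simp
      also have "\<dots> \<le> (cmod (1 - cnj (x n) * z))\<^sup>2 * (1 - (cmod (h z))\<^sup>2) * ((1 + cmod (h (x n))) * cmod (h (x n) - v))"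
      proof (intro mult_left_mono)
        have "1 - cmod (h (x n)) \<le> cmod (h (x n) - v)"
          using norm_triangle_ineq2[of v "h (x n)"] v by (simp add: norm_minus_commute)
        then have "(1 + cmod (h (x n))) * (1 - cmod (h (x n))) \<le> (1 + cmod (h (x n))) * cmod (h (x n) - v)"
          by (intro mult_left_mono) auto
        then show "1 - (cmod (h (x n)))\<^sup>2 \<le> (1 + cmod (h (x n))) * cmod (h (x n) - v)"
          by (simp add: power2_eq_square algebra_simps)
      qed (use one_minus_cmod_square_pos[OF h[OF z]] in auto)
      also have "\<dots> = ?R n * (1 - r n)"
        using r[of n] by (simp add: norm_divide xv)
      finally show ?thesis using r[of n] by simp
    qed
    moreover have "?L \<longlonglongrightarrow> (cmod (1 - cnj v * h z))\<^sup>2 * (1 - (cmod z)\<^sup>2) * (1 + 1)"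
      by (intro tendsto_intros h_lim r_lim)
    moreover have "?R \<longlonglongrightarrow> (cmod (1 - cnj v * z))\<^sup>2 * (1 - (cmod (h z))\<^sup>2) * ((1 + cmod v) * cmod (of_real c))"
      using x_lim by (intro tendsto_intros h_lim q_lim) (auto simp: filterlim_at)
    ultimately have "(cmod (1 - cnj v * h z))\<^sup>2 * (1 - (cmod z)\<^sup>2) * 2
      \<le> (cmod (1 - cnj v * z))\<^sup>2 * (1 - (cmod (h z))\<^sup>2) * (2 * c)"
      using LIMSEQ_le[of ?L _ ?R] v \<open>0 \<le> c\<close> by force
    also have "\<dots> \<le> (cmod (1 - cnj v * z))\<^sup>2 * (1 - (cmod (h z))\<^sup>2) * 2"
      using c one_minus_cmod_square_pos[OF h[OF z]] by (intro mult_left_mono) auto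
    finally show "(cmod (1 - cnj v * h z))\<^sup>2 * (1 - (cmod z)\<^sup>2) \<le> (cmod (1 - cnj v * z))\<^sup>2 * (1 - (cmod (h z))\<^sup>2)"
      by simp
  qed
qed

text \<open>Lets the study of the self-maps work with one inequality in place of fixed points and
  nontangential limits.\<close>

lemma denjoy_wolff_point_iff_julia:
  assumes holh: "h holomorphic_on ball 0 1" and maps: "h \<in> ball 0 1 \<rightarrow> ball 0 1"
  shows "denjoy_wolff_point h v \<longleftrightarrow> julia h v"
proof -
  have sub: "h ` ball 0 1 \<subseteq> cball 0 1"
    using maps by (auto simp: less_imp_le Pi_iff)
  consider "cmod v < 1" | "cmod v = 1" | "cmod v > 1" by linarith
  then show ?thesis
  proof cases
    case 1
    then show ?thesis
      using julia_interior_iff[OF holh maps 1] holh sub by (auto simp: denjoy_wolff_point_def)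
  next
    case 2
    show ?thesis
    proof
      assume "denjoy_wolff_point h v"
      then show "julia h v"
        using denjoy_wolff_imp_julia[OF holh maps 2] 2 by (auto simp: denjoy_wolff_point_def)
    next
      assume J: "julia h v"
      obtain c where c: "c \<le> 1" "nontangential_limit (\<lambda>z. (h z - v) / (z - v)) v (complex_of_real c)"
        using Julia_Caratheodory[OF holh maps J 2] by blast
      \<comment> \<open>The limit of \<open>h\<close> itself follows from the finite limit of the
        difference quotient.\<close>
      have "(h \<longlongrightarrow> v) (at v within stolz_angle v M)" if "M > 1" for M
      proof -
        have "((\<lambda>z. (h z - v) / (z - v) * (z - v) + v) \<longlongrightarrow> of_real c * (v - v) + v) (at v within stolz_angle v M)"
          using c that by (intro tendsto_intros) (auto simp: nontangential_limit_def)
        moreover have "(h z - v) / (z - v) * (z - v) + v = h z" if "z \<noteq> v" for z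
          using that by simp
        ultimately show ?thesis
          by (simp cong: Lim_cong_within)
      qed
      then show "denjoy_wolff_point h v"
        using c 2 holh sub by (auto simp: denjoy_wolff_point_def nontangential_limit_def)
    qed
  next
    case 3
    then show ?thesis by (simp add: denjoy_wolff_point_def julia_def)
  qed
qed

section \<open>The strip and the disk\<close>

lemma open_strip: "open strip"
  unfolding strip_def by (intro open_Collect_less continuous_intros)

lemma convex_strip: "convex strip"
proof -
  have "strip = {z. Im z < pi} \<inter> {z. Im z > - pi}"
    by (auto simp: strip_def)
  moreover have "convex \<dots>"
    by (intro convex_Int convex_halfspace_Im_lt convex_halfspace_Im_gt)
  ultimately show ?thesis by simp
qed

lemma strip_approximation:
  assumes "\<bar>Im z\<bar> \<le> pi"
  obtains X where "\<And>n. X n \<in> strip" "X \<longlonglongrightarrow> z"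
proof
  define r where "r n = 1 - 1 / real (n + 2)" for n
  show "of_real (r n) * z \<in> strip" for n
  proof -
    have "r n * \<bar>Im z\<bar> \<le> r n * pi" using assms by (intro mult_left_mono) (auto simp: r_def)
    also have "\<dots> < pi" by (simp add: r_def)
    finally show ?thesis by (simp add: strip_def abs_mult r_def)
  qed
  have "r \<longlonglongrightarrow> 1" unfolding r_def by real_asymp
  then have "(\<lambda>n. of_real (r n) * z) \<longlonglongrightarrow> of_real 1 * z" by (intro tendsto_intros)
  then show "(\<lambda>n. of_real (r n) * z) \<longlonglongrightarrow> z" by simp
qed

lemma closure_strip: "closure strip = {z. \<bar>Im z\<bar> \<le> pi}"
proof
  have "closed {z. \<bar>Im z\<bar> \<le> pi}"
    by (intro closed_Collect_le continuous_intros)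
  then show "closure strip \<subseteq> {z. \<bar>Im z\<bar> \<le> pi}"
    by (intro closure_minimal) (auto simp: strip_def)
  show "{z. \<bar>Im z\<bar> \<le> pi} \<subseteq> closure strip"
    by (auto simp: closure_sequential) (metis strip_approximation)
qed

lemma strip_subset_closure: "z \<in> strip \<Longrightarrow> z \<in> closure strip"
  using closure_subset by blast

lemma Re_exp_half_nonneg: "\<bar>Im z\<bar> \<le> pi \<Longrightarrow> 0 \<le> Re (exp (z / 2))"
  unfolding Re_exp by (intro mult_nonneg_nonneg cos_ge_zero) auto

lemma Re_exp_half_pos: "z \<in> strip \<Longrightarrow> 0 < Re (exp (z / 2))"
  unfolding Re_exp by (intro mult_pos_pos cos_gt_zero_pi) (auto simp: strip_def)

lemma exp_half_plus_one_nonzero: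
  assumes "\<bar>Im z\<bar> \<le> pi"
  shows "exp (z / 2) + 1 \<noteq> 0"
proof -
  have "Re (exp (z / 2) + 1) > 0" using Re_exp_half_nonneg[OF assms] by simp
  then show ?thesis by (metis less_irrefl zero_complex.sel(1))
qed

lemma strip_to_disk_norm:
  assumes "\<bar>Im z\<bar> \<le> pi"
  shows "1 - (cmod (strip_to_disk z))\<^sup>2 = 4 * Re (exp (z / 2)) / (cmod (exp (z / 2) + 1))\<^sup>2"
proof -
  have "(cmod (exp (z / 2) + 1))\<^sup>2 - (cmod (exp (z / 2) - 1))\<^sup>2 = 4 * Re (exp (z / 2))"
    unfolding cmod_power2 by (simp add: power2_eq_square algebra_simps)
  moreover have "(cmod (exp (z / 2) + 1))\<^sup>2 \<noteq> 0"
    using exp_half_plus_one_nonzero[OF assms] by simp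
  ultimately show ?thesis
    by (simp only: strip_to_disk_def norm_divide power_divide) (simp add: divide_simps)
qed

lemma strip_to_disk_cball:
  assumes "\<bar>Im z\<bar> \<le> pi"
  shows "cmod (strip_to_disk z) \<le> 1" "strip_to_disk z \<noteq> 1" "strip_to_disk z \<noteq> - 1"
proof -
  have "0 \<le> 1 - (cmod (strip_to_disk z))\<^sup>2"
    using Re_exp_half_nonneg[OF assms] unfolding strip_to_disk_norm[OF assms] by simp
  then show "cmod (strip_to_disk z) \<le> 1" by (simp add: abs_square_le_1)
  show "strip_to_disk z \<noteq> 1" "strip_to_disk z \<noteq> - 1"
    using exp_half_plus_one_nonzero[OF assms] by (auto simp: strip_to_disk_def divide_simps)
qed

lemma strip_to_disk_ball:
  assumes "z \<in> strip"
  shows "cmod (strip_to_disk z) < 1"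
proof -
  have "\<bar>Im z\<bar> \<le> pi" using assms by (simp add: strip_def)
  then have "0 < 1 - (cmod (strip_to_disk z))\<^sup>2"
    using Re_exp_half_pos[OF assms] exp_half_plus_one_nonzero by (simp add: strip_to_disk_norm)
  then show ?thesis by (simp add: abs_square_less_1)
qed

lemma Cayley_strip_to_disk:
  assumes "\<bar>Im z\<bar> \<le> pi"
  shows "(1 + strip_to_disk z) / (1 - strip_to_disk z) = exp (z / 2)"
  using exp_half_plus_one_nonzero[OF assms] by (simp add: strip_to_disk_def divide_simps)

lemma strip_to_disk_holomorphic: "strip_to_disk holomorphic_on strip"
  unfolding strip_to_disk_def using exp_half_plus_one_nonzero
  by (intro holomorphic_intros) (auto simp: strip_def)

lemma strip_to_disk_has_derivative:
  assumes "z \<in> strip"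
  shows "\<exists>D. D \<noteq> 0 \<and> (strip_to_disk has_field_derivative D) (at z)"
proof -
  have "exp (z / 2) + 1 \<noteq> 0" using assms exp_half_plus_one_nonzero by (auto simp: strip_def)
  then have "(strip_to_disk has_field_derivative exp (z / 2) / (exp (z / 2) + 1)\<^sup>2) (at z)"
    unfolding strip_to_disk_def
    by (auto intro!: derivative_eq_intros simp: power2_eq_square field_simps)
  with \<open>exp (z / 2) + 1 \<noteq> 0\<close> show ?thesis
    by (intro exI[of _ "exp (z / 2) / (exp (z / 2) + 1)\<^sup>2"]) auto
qed

text \<open>The inverse of \<open>strip_to_disk\<close>, written explicitly so that it also covers
  the circle apart from 1 and -1. There the Cayley transform lands in the closed right half-plane
  without 0, away from the branch cut of \<open>Ln\<close>.\<close>

definition disk_to_strip :: "complex \<Rightarrow> complex" where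
  "disk_to_strip z = 2 * Ln ((1 + z) / (1 - z))"

lemma disk_to_strip_to_disk:
  assumes "\<bar>Im z\<bar> \<le> pi"
  shows "disk_to_strip (strip_to_disk z) = z"
proof -
  have "- pi < Im (z / 2)" "Im (z / 2) \<le> pi"
    using abs_le_D1[OF assms] abs_le_D2[OF assms] pi_gt_zero unfolding Im_divide_numeral by linarith+
  then have "Ln (exp (z / 2)) = z / 2" by (rule Ln_exp)
  then show ?thesis
    by (simp only: disk_to_strip_def Cayley_strip_to_disk[OF assms]) simp
qed

lemma Re_Cayley_1: "z \<noteq> 1 \<Longrightarrow> Re ((1 + z) / (1 - z)) = (1 - (cmod z)\<^sup>2) / (cmod (1 - z))\<^sup>2"
  using Re_Cayley[of 1 z] by simp

lemma Cayley_nonzero: "z \<noteq> 1 \<Longrightarrow> z \<noteq> - 1 \<Longrightarrow> (1 + z) / (1 - z) \<noteq> (0 :: complex)"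
  by (auto simp: add_eq_0_iff)

lemma strip_to_disk_to_strip:
  assumes "z \<noteq> 1" "z \<noteq> - 1"
  shows "strip_to_disk (disk_to_strip z) = z"
proof -
  have "exp (disk_to_strip z / 2) = (1 + z) / (1 - z)"
    using Cayley_nonzero[OF assms] by (simp add: disk_to_strip_def)
  moreover have "(1 + z) / (1 - z) - 1 = 2 * z / (1 - z)" "(1 + z) / (1 - z) + 1 = 2 / (1 - z)"
    using assms by (simp_all add: field_simps)
  ultimately show ?thesis
    using assms by (simp add: strip_to_disk_def)
qed

lemma disk_to_strip_closed:
  assumes "cmod z \<le> 1" "z \<noteq> 1" "z \<noteq> - 1"
  shows "\<bar>Im (disk_to_strip z)\<bar> \<le> pi"
proof -
  have "0 \<le> Re ((1 + z) / (1 - z))"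
    using assms by (simp add: Re_Cayley_1 abs_square_le_1)
  then have "\<bar>Im (Ln ((1 + z) / (1 - z)))\<bar> \<le> pi / 2"
    using Cayley_nonzero[OF assms(2,3)] Re_Ln_pos_le by blast
  then show ?thesis by (simp add: disk_to_strip_def)
qed

lemma disk_to_strip_strip:
  assumes "cmod z < 1"
  shows "disk_to_strip z \<in> strip"
proof -
  have "z \<noteq> 1" "z \<noteq> - 1" using assms by auto
  then have "0 < Re ((1 + z) / (1 - z))"
    using assms by (simp add: Re_Cayley_1 abs_square_less_1)
  then have "\<bar>Im (Ln ((1 + z) / (1 - z)))\<bar> < pi / 2"
    using Cayley_nonzero[OF \<open>z \<noteq> 1\<close> \<open>z \<noteq> - 1\<close>] Re_Ln_pos_lt by blast
  then show ?thesis by (simp add: disk_to_strip_def strip_def)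
qed

lemma Cayley_notin_nonpos_Reals:
  assumes "cmod z \<le> 1" "z \<noteq> 1" "z \<noteq> - 1"
  shows "(1 + z) / (1 - z) \<notin> \<real>\<^sub>\<le>\<^sub>0"
proof
  assume "(1 + z) / (1 - z) \<in> \<real>\<^sub>\<le>\<^sub>0"
  moreover have "0 \<le> Re ((1 + z) / (1 - z))"
    using assms by (simp add: Re_Cayley_1 abs_square_le_1)
  ultimately have "(1 + z) / (1 - z) = 0"
    by (auto simp: complex_nonpos_Reals_iff complex_eq_iff simp del: Re_divide Im_divide)
  then show False using Cayley_nonzero[OF assms(2,3)] by simp
qed

lemma disk_to_strip_holomorphic: "disk_to_strip holomorphic_on ball 0 1"
proof -
  have "z \<noteq> 1" "(1 + z) / (1 - z) \<notin> \<real>\<^sub>\<le>\<^sub>0" if "cmod z < 1" for z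
  proof -
    show "z \<noteq> 1" using that by auto
    moreover have "z \<noteq> - 1" using that by auto
    ultimately show "(1 + z) / (1 - z) \<notin> \<real>\<^sub>\<le>\<^sub>0"
      using Cayley_notin_nonpos_Reals[of z] that by simp
  qed
  then show ?thesis
    unfolding disk_to_strip_def by (intro holomorphic_intros) auto
qed

lemma disk_to_strip_continuous: "continuous_on (cball 0 1 - {1, - 1}) disk_to_strip"
  unfolding disk_to_strip_def using Cayley_notin_nonpos_Reals
  by (intro continuous_intros) auto

lemma inv_strip_to_disk:
  assumes "cmod z < 1"
  shows "inv_into strip strip_to_disk z = disk_to_strip z"
proof (rule inv_into_f_eq)
  show "inj_on strip_to_disk strip"
    by (rule inj_on_inverseI[where g=disk_to_strip]) (auto simp: strip_def disk_to_strip_to_disk)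
  show "disk_to_strip z \<in> strip" by (rule disk_to_strip_strip[OF assms])
  show "strip_to_disk (disk_to_strip z) = z"
    using assms by (intro strip_to_disk_to_strip) auto
qed

section \<open>Conjugation to the disk, and Julia's inequality in strip coordinates\<close>

lemma conj_to_disk_eq:
  "cmod z < 1 \<Longrightarrow> conj_to_disk g z = strip_to_disk (g (disk_to_strip z))"
  by (simp add: conj_to_disk_def inv_strip_to_disk)

lemma conj_to_disk_strip_to_disk:
  "z \<in> strip \<Longrightarrow> conj_to_disk g (strip_to_disk z) = strip_to_disk (g z)"
  using strip_to_disk_ball by (simp add: conj_to_disk_eq disk_to_strip_to_disk strip_def)

lemma conj_to_disk_holomorphic:
  assumes holg: "g holomorphic_on strip" and g: "\<And>z. z \<in> strip \<Longrightarrow> g z \<in> strip"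
  shows "conj_to_disk g holomorphic_on ball 0 1" "conj_to_disk g \<in> ball 0 1 \<rightarrow> ball 0 1"
proof -
  have "strip_to_disk \<circ> (g \<circ> disk_to_strip) holomorphic_on ball 0 1"
  proof (rule holomorphic_on_compose_gen[OF _ strip_to_disk_holomorphic])
    show "g \<circ> disk_to_strip holomorphic_on ball 0 1"
      using disk_to_strip_strip by (intro holomorphic_on_compose_gen[OF disk_to_strip_holomorphic holg]) auto
    show "(g \<circ> disk_to_strip) ` ball 0 1 \<subseteq> strip" using g disk_to_strip_strip by auto
  qed
  then show "conj_to_disk g holomorphic_on ball 0 1"
    by (rule holomorphic_transform) (simp add: conj_to_disk_eq)
  show "conj_to_disk g \<in> ball 0 1 \<rightarrow> ball 0 1"
    using g disk_to_strip_strip strip_to_disk_ball by (auto simp: conj_to_disk_eq)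
qed

lemma conj_to_disk_fixed_iff:
  assumes "z \<in> strip" "g z \<in> strip"
  shows "conj_to_disk g (strip_to_disk z) = strip_to_disk z \<longleftrightarrow> g z = z"
  using assms disk_to_strip_to_disk[of z] disk_to_strip_to_disk[of "g z"]
  by (auto simp: conj_to_disk_strip_to_disk strip_def)

text \<open>At 1, that is, at +infinity, the gauge is the reciprocal of
  \<open>Re (exp (z / 2))\<close>, because the Cayley transform leads from the disk back to the
  half-plane.\<close>

lemma julia_conj_to_disk_at_1:
  assumes "julia (conj_to_disk g) 1" "z \<in> strip" "g z \<in> strip"
  shows "Re (exp (z / 2)) \<le> Re (exp (g z / 2))"
proof -
  have *: "(1 - (cmod (strip_to_disk x))\<^sup>2) / (cmod (1 - strip_to_disk x))\<^sup>2 = Re (exp (x / 2))"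
    and "1 - strip_to_disk x \<noteq> 0" if "x \<in> strip" for x
    using that Re_Cayley_1[of "strip_to_disk x"] Cayley_strip_to_disk[of x] strip_to_disk_cball[of x]
    by (auto simp: strip_def)
  moreover have "(cmod (1 - strip_to_disk (g z)))\<^sup>2 * (1 - (cmod (strip_to_disk z))\<^sup>2)
      \<le> (cmod (1 - strip_to_disk z))\<^sup>2 * (1 - (cmod (strip_to_disk (g z)))\<^sup>2)"
    using assms strip_to_disk_ball[OF assms(2)] by (auto simp: julia_def simp flip: conj_to_disk_strip_to_disk)
  moreover have "a / p \<le> b / q" if "q * a \<le> p * b" "p > 0" "q > 0" for a b p q :: real
    using that by (simp add: field_simps)
  ultimately have "(1 - (cmod (strip_to_disk z))\<^sup>2) / (cmod (1 - strip_to_disk z))\<^sup>2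
      \<le> (1 - (cmod (strip_to_disk (g z)))\<^sup>2) / (cmod (1 - strip_to_disk (g z)))\<^sup>2"
    using assms by (metis norm_eq_zero zero_less_power2)
  then show ?thesis
    using *[OF assms(2)] *[OF assms(3)] by simp
qed

text \<open>At -1 the Cayley transform is replaced by its reciprocal, which turns the exponent
  \<open>z / 2\<close> into \<open>- z / 2\<close>.\<close>

lemma julia_conj_to_disk_at_minus_1:
  assumes "julia (conj_to_disk g) (- 1)" "z \<in> strip" "g z \<in> strip"
  shows "Re (exp (- z / 2)) \<le> Re (exp (- g z / 2))"
proof -
  have *: "(1 - (cmod (strip_to_disk x))\<^sup>2) / (cmod (1 + strip_to_disk x))\<^sup>2 = Re (exp (- x / 2))"
    and "1 + strip_to_disk x \<noteq> 0" if "x \<in> strip" for x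
  proof -
    have "strip_to_disk x \<noteq> - 1" and x: "\<bar>Im x\<bar> \<le> pi"
      using strip_to_disk_cball that by (auto simp: strip_def)
    then show "1 + strip_to_disk x \<noteq> 0" by (simp add: add_eq_0_iff)
    have "- strip_to_disk x \<noteq> 1" using \<open>strip_to_disk x \<noteq> - 1\<close> by (metis minus_minus)
    then have "(1 - (cmod (strip_to_disk x))\<^sup>2) / (cmod (1 + strip_to_disk x))\<^sup>2
      = Re ((1 - strip_to_disk x) / (1 + strip_to_disk x))"
      using Re_Cayley_1[of "- strip_to_disk x"] by simp
    also have "(1 - strip_to_disk x) / (1 + strip_to_disk x) = inverse ((1 + strip_to_disk x) / (1 - strip_to_disk x))"
      by simp
    also have "\<dots> = exp (- x / 2)" unfolding Cayley_strip_to_disk[OF x] by (simp add: exp_minus)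
    finally show "(1 - (cmod (strip_to_disk x))\<^sup>2) / (cmod (1 + strip_to_disk x))\<^sup>2 = Re (exp (- x / 2))" .
  qed
  moreover have "(cmod (1 + strip_to_disk (g z)))\<^sup>2 * (1 - (cmod (strip_to_disk z))\<^sup>2)
      \<le> (cmod (1 + strip_to_disk z))\<^sup>2 * (1 - (cmod (strip_to_disk (g z)))\<^sup>2)"
    using assms strip_to_disk_ball[OF assms(2)] by (auto simp: julia_def simp flip: conj_to_disk_strip_to_disk)
  moreover have "a / p \<le> b / q" if "q * a \<le> p * b" "p > 0" "q > 0" for a b p q :: real
    using that by (simp add: field_simps)
  ultimately have "(1 - (cmod (strip_to_disk z))\<^sup>2) / (cmod (1 + strip_to_disk z))\<^sup>2
      \<le> (1 - (cmod (strip_to_disk (g z)))\<^sup>2) / (cmod (1 + strip_to_disk (g z)))\<^sup>2"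
    using assms by (metis norm_eq_zero zero_less_power2)
  then show ?thesis
    using *[OF assms(2)] *[OF assms(3)] by simp
qed

text \<open>Julia's inequality at a point \<open>v\<close> of the circle forces
  \<open>conj_to_disk g\<close> to have radial limit \<open>v\<close>. Away from 1 and -1 this can
  be read in the strip: a limit of values of \<open>g\<close> has imaginary part of modulus at most
  \<open>b\<close>, yet would correspond to the boundary point \<open>v\<close>.\<close>

lemma julia_conj_to_disk_boundary_Im:
  assumes holg: "g holomorphic_on strip" and g: "\<And>z. z \<in> strip \<Longrightarrow> \<bar>Im (g z)\<bar> \<le> b" and b: "b < pi"
    and J: "julia (conj_to_disk g) v" and v1: "v \<noteq> 1" "v \<noteq> - 1"
  shows "cmod v < 1"
proof (rule ccontr)
  assume "\<not> cmod v < 1"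
  then have v: "cmod v = 1" using J by (simp add: julia_def)
  have gs: "g z \<in> strip" if "z \<in> strip" for z using g[OF that] b by (simp add: strip_def)
  note H = conj_to_disk_holomorphic[OF holg gs]
  let ?h = "conj_to_disk g"
  define r where "r n = 1 - 1 / real (n + 2)" for n
  have r: "0 < r n" "r n < 1" for n by (auto simp: r_def)
  have r_lim: "r \<longlonglongrightarrow> 1"
    unfolding r_def by real_asymp
  define x where "x n = of_real (r n) * v" for n
  have nx: "cmod (x n) = r n" for n using v r by (simp add: x_def norm_mult less_imp_le)
  have hx: "cmod (?h (x n)) < 1" for n using H(2) nx[of n] r[of n] by auto
  have bound: "(cmod (v - ?h (x n)))\<^sup>2 \<le> 1 - r n" for n
  proof -
    have vx: "v - x n = of_real (1 - r n) * v" by (simp add: x_def algebra_simps)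
    have "cmod (v - x n) = 1 - r n"
      unfolding vx norm_mult using r[of n] v by (simp only: norm_of_real) simp
    moreover have "(cmod (1 - cnj v * ?h (x n)))\<^sup>2 * (1 - (cmod (x n))\<^sup>2) \<le> (cmod (1 - cnj v * x n))\<^sup>2 * (1 - (cmod (?h (x n)))\<^sup>2)"
      using J r[of n] nx[of n] unfolding julia_def by (metis mem_ball_0)
    ultimately have "(cmod (v - ?h (x n)))\<^sup>2 * (1 - (r n)\<^sup>2) \<le> (1 - r n)\<^sup>2 * (1 - (cmod (?h (x n)))\<^sup>2)"
      by (simp only: norm_one_minus_cnj_mult_unit[OF v] nx)
    also have "\<dots> \<le> (1 - r n)\<^sup>2 * 1" by (intro mult_left_mono) auto
    finally have "(1 - r n) * ((cmod (v - ?h (x n)))\<^sup>2 * (1 + r n)) \<le> (1 - r n) * (1 - r n)"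
      by (simp add: power2_eq_square algebra_simps)
    then have "(cmod (v - ?h (x n)))\<^sup>2 * (1 + r n) \<le> 1 - r n" using r[of n] by simp
    moreover have "(cmod (v - ?h (x n)))\<^sup>2 * 1 \<le> (cmod (v - ?h (x n)))\<^sup>2 * (1 + r n)"
      using r[of n] by (intro mult_left_mono) auto
    ultimately show ?thesis by simp
  qed
  have "(\<lambda>n. 1 - r n) \<longlonglongrightarrow> 1 - 1" by (intro tendsto_intros r_lim)
  then have "(\<lambda>n. 1 - r n) \<longlonglongrightarrow> 0" by simp
  then have "(\<lambda>n. (cmod (v - ?h (x n)))\<^sup>2) \<longlonglongrightarrow> 0"
    by (rule tendsto_sandwich[rotated 3, where f="\<lambda>_. 0"]) (use bound in auto)
  then have "(\<lambda>n. cmod (v - ?h (x n))) \<longlonglongrightarrow> 0"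
    using tendsto_real_sqrt by fastforce
  then have "(\<lambda>n. v - (v - ?h (x n))) \<longlonglongrightarrow> v - 0"
    by (intro tendsto_intros) (rule tendsto_norm_zero_cancel)
  then have "(\<lambda>n. ?h (x n)) \<longlonglongrightarrow> v" by simp
  moreover have "?h (x n) \<noteq> 1" "?h (x n) \<noteq> - 1" for n
    using hx[of n] by auto
  ultimately have "(\<lambda>n. disk_to_strip (?h (x n))) \<longlonglongrightarrow> disk_to_strip v"
    using hx v v1 by (intro continuous_on_tendsto_compose[OF disk_to_strip_continuous]) (auto simp: less_imp_le intro!: always_eventually)
  moreover have "disk_to_strip (?h (x n)) = g (disk_to_strip (x n))" for n
    using disk_to_strip_to_disk[of "g (disk_to_strip (x n))"] gs[OF disk_to_strip_strip[of "x n"]] nx[of n] r[of n]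
    by (simp add: conj_to_disk_eq strip_def)
  ultimately have "(\<lambda>n. \<bar>Im (g (disk_to_strip (x n)))\<bar>) \<longlonglongrightarrow> \<bar>Im (disk_to_strip v)\<bar>"
    by (intro tendsto_intros) auto
  then have "\<bar>Im (disk_to_strip v)\<bar> \<le> b"
    using g[OF disk_to_strip_strip] nx r by (intro LIMSEQ_le_const2) auto
  then have "disk_to_strip v \<in> strip" using b by (simp add: strip_def)
  then show False
    using strip_to_disk_ball[of "disk_to_strip v"] strip_to_disk_to_strip[OF v1] v by simp
qed

section \<open>The self-maps of the strip and their Denjoy-Wolff points\<close>

locale strip_inner_map =
  fixes f :: "complex \<Rightarrow> complex" and k :: real
  assumes holf: "f holomorphic_on strip"
    and cnj_f: "\<And>z. z \<in> strip \<Longrightarrow> f (cnj z) = cnj (f z)"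
    and k: "k > 1"
    and Im_f: "\<And>z. z \<in> strip \<Longrightarrow> Im z > 0 \<Longrightarrow> Im z \<le> Im (f z) \<and> Im (f z) \<le> k * Im z"
begin

lemma Im_f_neg:
  assumes "z \<in> strip" "Im z < 0"
  shows "k * Im z \<le> Im (f z)" "Im (f z) \<le> Im z"
  using Im_f[of "cnj z"] cnj_f[of z] assms by (auto simp: strip_def)

lemma Im_f_real:
  assumes "z \<in> strip" "Im z = 0"
  shows "Im (f z) = 0"
proof -
  have "cnj z = z" using assms by (simp add: complex_eq_iff)
  then have "Im (f z) = Im (cnj (f z))" using cnj_f[OF assms(1)] by simp
  then show ?thesis by simp
qed

lemma abs_Im_f_ge:
  assumes "z \<in> strip"
  shows "\<bar>Im z\<bar> \<le> \<bar>Im (f z)\<bar>"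
  using Im_f[OF assms] Im_f_neg[OF assms] by linarith

text \<open>Ensures that no \<open>self_map\<close> with positive parameter is the identity, the one
  map with several Denjoy-Wolff points. The reason is that \<open>f\<close> is real at 0 but not at
  \<i>.\<close>

lemma f_not_constant: "\<exists>z\<in>strip. f z \<noteq> \<alpha>"
proof (rule ccontr)
  assume "\<not> ?thesis"
  moreover have "0 \<in> strip" "\<i> \<in> strip" using pi_gt3 by (auto simp: strip_def)
  ultimately have "f 0 = f \<i>" by metis
  then show False
    using Im_f[OF \<open>\<i> \<in> strip\<close>] Im_f_real[OF \<open>0 \<in> strip\<close>] by simp
qed

context
  fixes \<tau> :: real
  assumes \<tau>: "0 < \<tau>" "\<tau> \<le> 2 / (k + 1)"
begin

lemma tau_bounds: "\<tau> * (k + 1) \<le> 2" "\<tau> < 1"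
proof -
  show "\<tau> * (k + 1) \<le> 2" using \<tau> k by (simp add: field_simps)
  have "\<tau> * 2 < \<tau> * (k + 1)" using \<tau> k by simp
  also have "\<dots> \<le> 2" by fact
  finally show "\<tau> < 1" by simp
qed

text \<open>For y = Im z > 0 the number Im z - \<tau> Im (f z) lies between (1 - \<tau> k) y and (1
  - \<tau>) y. The lower end is at least -(1 - \<tau>) y exactly when \<tau> (k + 1) \<le> 2, the
  upper bound on \<tau>. The lower half of the strip follows by symmetry.\<close>

lemma Im_self_map:
  assumes z: "z \<in> strip"
  shows "\<bar>Im (self_map \<tau> f \<alpha> z)\<bar> \<le> (1 - \<tau>) * \<bar>Im z\<bar> + \<tau> * \<bar>Im \<alpha>\<bar>"
proof -
  have pos: "\<bar>y - \<tau> * d\<bar> \<le> (1 - \<tau>) * y" if "0 \<le> y" "y \<le> d" "d \<le> k * y" for y d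
  proof -
    have "\<tau> * y \<le> \<tau> * d" "\<tau> * d \<le> \<tau> * (k * y)" "\<tau> * (k + 1) * y \<le> 2 * y"
      using \<tau> tau_bounds that by (auto intro: mult_left_mono mult_right_mono)
    then show ?thesis by (simp add: abs_le_iff algebra_simps)
  qed
  have "\<bar>Im z - \<tau> * Im (f z)\<bar> \<le> (1 - \<tau>) * \<bar>Im z\<bar>"
    using pos[of "Im z" "Im (f z)"] pos[of "- Im z" "- Im (f z)"] Im_f[OF z] Im_f_neg[OF z] Im_f_real[OF z]
    by (cases "Im z" "0 :: real" rule: linorder_cases) (auto simp: abs_minus_commute)
  moreover have "Im (self_map \<tau> f \<alpha> z) = (Im z - \<tau> * Im (f z)) + \<tau> * Im \<alpha>"
    by (simp add: self_map_def algebra_simps)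
  ultimately show ?thesis
    using \<tau> abs_triangle_ineq[of "Im z - \<tau> * Im (f z)" "\<tau> * Im \<alpha>"] by (simp add: abs_mult)
qed

lemma Im_self_map_le:
  assumes z: "z \<in> strip"
  shows "\<bar>Im (self_map \<tau> f \<alpha> z)\<bar> \<le> (1 - \<tau>) * pi + \<tau> * \<bar>Im \<alpha>\<bar>"
proof -
  have "(1 - \<tau>) * \<bar>Im z\<bar> \<le> (1 - \<tau>) * pi"
    using z tau_bounds by (intro mult_left_mono) (auto simp: strip_def)
  then show ?thesis using Im_self_map[OF z, of \<alpha>] by simp
qed

lemma self_map_strip:
  assumes z: "z \<in> strip" and \<alpha>: "\<alpha> \<in> closure strip"
  shows "self_map \<tau> f \<alpha> z \<in> strip"
proof -
  have "\<tau> * \<bar>Im \<alpha>\<bar> \<le> \<tau> * pi"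
    using \<tau> \<alpha> by (simp add: closure_strip)
  moreover have "(1 - \<tau>) * \<bar>Im z\<bar> < (1 - \<tau>) * pi"
    using z tau_bounds by (simp add: strip_def)
  ultimately show ?thesis
    using Im_self_map[OF z, of \<alpha>] by (simp add: strip_def algebra_simps)
qed

lemma self_map_holomorphic: "self_map \<tau> f \<alpha> holomorphic_on strip"
  unfolding self_map_def by (intro holomorphic_intros holf)

lemma self_map_fixed_iff: "self_map \<tau> f \<alpha> z = z \<longleftrightarrow> f z = \<alpha>"
  using \<tau> by (simp add: self_map_def)

lemma conj_self_map_holomorphic:
  assumes "\<alpha> \<in> closure strip"
  shows "conj_to_disk (self_map \<tau> f \<alpha>) holomorphic_on ball 0 1"
    "conj_to_disk (self_map \<tau> f \<alpha>) \<in> ball 0 1 \<rightarrow> ball 0 1"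
  by (rule conj_to_disk_holomorphic[OF self_map_holomorphic self_map_strip]; use assms in simp)+

lemma julia_self_map_unique:
  assumes \<alpha>: "\<alpha> \<in> closure strip"
    and "julia (conj_to_disk (self_map \<tau> f \<alpha>)) v" "julia (conj_to_disk (self_map \<tau> f \<alpha>)) w"
  shows "v = w"
proof (rule ccontr)
  assume "v \<noteq> w"
  obtain z where z: "z \<in> strip" "f z \<noteq> \<alpha>" using f_not_constant by blast
  have "conj_to_disk (self_map \<tau> f \<alpha>) (strip_to_disk z) = strip_to_disk z"
    by (rule julia_unique[OF conj_self_map_holomorphic[OF \<alpha>] assms(2,3) \<open>v \<noteq> w\<close> strip_to_disk_ball[OF z(1)]])
  then show False
    using conj_to_disk_fixed_iff[of z "self_map \<tau> f \<alpha>"] z self_map_strip[OF z(1) \<alpha>] by (simp add: self_map_fixed_iff)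
qed

lemma julia_self_map_fixed_point:
  assumes \<alpha>: "\<alpha> \<in> closure strip" and z: "z \<in> strip"
  shows "julia (conj_to_disk (self_map \<tau> f \<alpha>)) (strip_to_disk z) \<longleftrightarrow> f z = \<alpha>"
  using julia_interior_iff[OF conj_self_map_holomorphic[OF \<alpha>] strip_to_disk_ball[OF z]]
    conj_to_disk_fixed_iff[of z "self_map \<tau> f \<alpha>"] self_map_strip[OF z \<alpha>] z by (simp add: self_map_fixed_iff)

lemma julia_self_map_limit:
  assumes \<alpha>: "\<And>n. \<alpha> n \<in> closure strip" and lim: "\<alpha> \<longlonglongrightarrow> \<alpha>\<^sub>0" and v: "v \<longlonglongrightarrow> v\<^sub>0"
    and J: "\<And>n::nat. julia (conj_to_disk (self_map \<tau> f (\<alpha> n))) (v n)"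
  shows "julia (conj_to_disk (self_map \<tau> f \<alpha>\<^sub>0)) v\<^sub>0"
proof (rule julia_limit[OF v _ J])
  fix z :: complex assume "cmod z < 1"
  have \<alpha>\<^sub>0: "\<alpha>\<^sub>0 \<in> closure strip"
    using \<alpha> by (intro closed_sequentially[OF closed_closure _ lim]) simp
  let ?z = "disk_to_strip z"
  note z = disk_to_strip_strip[OF \<open>cmod z < 1\<close>]
  have "(\<lambda>n. self_map \<tau> f (\<alpha> n) ?z) \<longlonglongrightarrow> self_map \<tau> f \<alpha>\<^sub>0 ?z"
    unfolding self_map_def by (intro tendsto_intros lim)
  then have "(\<lambda>n. strip_to_disk (self_map \<tau> f (\<alpha> n) ?z)) \<longlonglongrightarrow> strip_to_disk (self_map \<tau> f \<alpha>\<^sub>0 ?z)"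
    by (rule continuous_on_tendsto_compose[OF holomorphic_on_imp_continuous_on[OF strip_to_disk_holomorphic]])
       (simp_all add: self_map_strip[OF z] \<alpha> \<alpha>\<^sub>0)
  then show "(\<lambda>n. conj_to_disk (self_map \<tau> f (\<alpha> n)) z) \<longlonglongrightarrow> conj_to_disk (self_map \<tau> f \<alpha>\<^sub>0) z"
    using \<open>cmod z < 1\<close> by (simp add: conj_to_disk_eq)
qed

end

section \<open>Growth on the real axis, and exclusion of the points at infinity\<close>

text \<open>As \<open>f\<close> is real on the real axis, the difference quotient in the direction
  \<i> has real part Im (f (x + \<i> s)) / s, which is at least 1 for small s > 0.\<close>

lemma Re_deriv_f_real:
  assumes "Im x = 0"
  shows "1 \<le> Re (deriv f x)"
proof -
  have x: "x \<in> strip" using assms by (simp add: strip_def)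
  then have "(f has_field_derivative deriv f x) (at x)"
    using holomorphic_derivI[OF holf open_strip] by blast
  then have "((\<lambda>h. (f (x + h) - f x) / h) \<longlongrightarrow> deriv f x) (at 0)"
    by (simp add: DERIV_def)
  moreover have "filterlim (\<lambda>s. \<i> * of_real s) (at 0) (at_right (0::real))"
    unfolding filterlim_at
    by (auto intro!: tendsto_eq_intros simp: eventually_at_filter)
  ultimately have "((\<lambda>s. (f (x + \<i> * of_real s) - f x) / (\<i> * of_real s)) \<longlongrightarrow> deriv f x) (at_right (0::real))"
    by (rule filterlim_compose)
  then have "((\<lambda>s. Re ((f (x + \<i> * of_real s) - f x) / (\<i> * of_real s))) \<longlongrightarrow> Re (deriv f x)) (at_right (0::real))"
    by (rule tendsto_Re)
  moreover have "\<forall>\<^sub>F s in at_right (0::real). 1 \<le> Re ((f (x + \<i> * of_real s) - f x) / (\<i> * of_real s))"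
  proof (rule eventually_at_rightI[of 0 pi])
    fix s :: real assume s: "s \<in> {0<..<pi}"
    have "Re (y / (\<i> * of_real s)) = Im y / s" for y
      using s by (simp add: complex_eq_iff field_simps Re_divide power2_eq_square)
    moreover have "s \<le> Im (f (x + \<i> * of_real s) - f x)"
      using Im_f[of "x + \<i> * of_real s"] Im_f_real[OF x assms] s assms by (simp add: strip_def)
    ultimately show "1 \<le> Re ((f (x + \<i> * of_real s) - f x) / (\<i> * of_real s))"
      using s by simp
  qed (use pi_gt_zero in auto)
  ultimately show ?thesis
    by (intro tendsto_lowerbound) auto
qed

lemma Re_f_real_growth:
  fixes x y :: real
  assumes "x \<le> y"
  shows "y - x \<le> Re (f (of_real y)) - Re (f (of_real x))"
proof -
  have Im0: "Im u = 0" if "u \<in> closed_segment (of_real x) (of_real y)" for u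
    using that by (auto simp: closed_segment_def)
  then have "(f has_field_derivative deriv f u) (at u)" if "u \<in> closed_segment (of_real x) (of_real y)" for u
    using that holomorphic_derivI[OF holf open_strip, of u UNIV] by (simp add: strip_def)
  then obtain u where u: "u \<in> closed_segment (of_real x) (of_real y)"
    "Re (f (of_real y)) - Re (f (of_real x)) = Re (deriv f u * (of_real y - of_real x))"
    using complex_mvt_line by blast
  have "1 * (y - x) \<le> Re (deriv f u) * (y - x)"
    using Re_deriv_f_real[OF Im0[OF u(1)]] assms by (intro mult_right_mono) auto
  then show ?thesis using u(2) by simp
qed

text \<open>If \<open>v\<close> were 1, Julia's inequality at real points would say that the
  self-map does not decrease their real part, so Re f \<le> Re \<alpha> on the whole axis. This
  fails far to the right, where Re f grows at least linearly. The point -1 is excluded in the same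
  way on the left.\<close>

lemma julia_self_map_finite:
  assumes \<tau>: "0 < \<tau>" "\<tau> \<le> 2 / (k + 1)" and \<alpha>: "\<alpha> \<in> closure strip"
    and J: "julia (conj_to_disk (self_map \<tau> f \<alpha>)) v"
  shows "v \<noteq> 1" "v \<noteq> - 1"
proof -
  let ?g = "self_map \<tau> f \<alpha>"
  have strip: "of_real x \<in> strip" "?g (of_real x) \<in> strip" for x
    using self_map_strip[OF \<tau> _ \<alpha>] by (auto simp: strip_def)
  \<comment> \<open>Longer than the distance from Re (f 0) to Re \<alpha>, so that the growth of Re
    f over an interval of length \<open>R\<close> overtakes it.\<close>
  define R where "R = \<bar>Re \<alpha> - Re (f 0)\<bar> + 1"
  have R: "0 \<le> R" "\<bar>Re \<alpha> - Re (f 0)\<bar> < R" by (auto simp: R_def)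
  have Re_exp_le: "Re (exp (z / 2)) \<le> exp (Re z / 2)" for z :: complex
    using complex_Re_le_cmod[of "exp (z / 2)"] by simp
  show "v \<noteq> 1"
  proof
    assume "v = 1"
    have "Re (f (of_real x)) \<le> Re \<alpha>" for x
    proof -
      have "exp (x / 2) = Re (exp (of_real x / 2))" by (simp add: Re_exp)
      also have "\<dots> \<le> Re (exp (?g (of_real x) / 2))"
        using J \<open>v = 1\<close> strip by (intro julia_conj_to_disk_at_1) auto
      also have "\<dots> \<le> exp (Re (?g (of_real x)) / 2)" by (rule Re_exp_le)
      finally have "\<tau> * (Re (f (of_real x)) - Re \<alpha>) \<le> 0"
        by (simp add: self_map_def)
      then show ?thesis using \<tau> by (simp add: mult_le_0_iff)
    qed
    from this[of R] Re_f_real_growth[of 0 R] R show False by simp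
  qed
  show "v \<noteq> - 1"
  proof
    assume "v = - 1"
    have "Re \<alpha> \<le> Re (f (of_real x))" for x
    proof -
      have "exp (- x / 2) = Re (exp (- of_real x / 2))" by (simp add: Re_exp)
      also have "\<dots> \<le> Re (exp (- ?g (of_real x) / 2))"
        using J \<open>v = - 1\<close> strip by (intro julia_conj_to_disk_at_minus_1) auto
      also have "\<dots> \<le> exp (Re (- ?g (of_real x)) / 2)" by (rule Re_exp_le)
      finally have "0 \<le> \<tau> * (Re (f (of_real x)) - Re \<alpha>)"
        by (simp add: self_map_def)
      then show ?thesis using \<tau> by (simp add: zero_le_mult_iff)
    qed
    from this[of "- R"] Re_f_real_growth[of "- R" 0] R show False by simp
  qed
qed

text \<open>The function \<open>\<omega>\<close> is built from one admissible \<open>\<tau>\<close>; it serves all the others, since inside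
  the strip the fixed points do not depend on \<open>\<tau>\<close> and the boundary follows by continuity.\<close>

definition \<tau>\<^sub>0 :: real where "\<tau>\<^sub>0 = 2 / (k + 1)"

lemma tau0: "0 < \<tau>\<^sub>0" "\<tau>\<^sub>0 \<le> 2 / (k + 1)"
  using k by (auto simp: \<tau>\<^sub>0_def)

section \<open>The inverse function \<omega> on the closed strip\<close>

definition fixpt :: "complex \<Rightarrow> complex" where
  "fixpt \<alpha> = (SOME v. julia (conj_to_disk (self_map \<tau>\<^sub>0 f \<alpha>)) v)"

definition \<omega> :: "complex \<Rightarrow> complex" where
  "\<omega> \<alpha> = disk_to_strip (fixpt \<alpha>)"

lemma julia_fixpt:
  assumes "\<alpha> \<in> closure strip"
  shows "julia (conj_to_disk (self_map \<tau>\<^sub>0 f \<alpha>)) (fixpt \<alpha>)"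
  unfolding fixpt_def
  by (rule someI_ex, rule julia_exists[OF conj_self_map_holomorphic[OF tau0 assms]])

lemma fixpt_eqI:
  assumes "\<alpha> \<in> closure strip" "julia (conj_to_disk (self_map \<tau>\<^sub>0 f \<alpha>)) v"
  shows "fixpt \<alpha> = v"
  using julia_self_map_unique[OF tau0 assms(1) julia_fixpt assms(2)] assms(1) by blast

lemma fixpt_cball:
  assumes "\<alpha> \<in> closure strip"
  shows "fixpt \<alpha> \<in> cball 0 1 - {1, - 1}"
  using julia_fixpt[OF assms] julia_self_map_finite[OF tau0 assms julia_fixpt[OF assms]]
  by (auto simp: julia_def)

lemma strip_to_disk_omega: "\<alpha> \<in> closure strip \<Longrightarrow> strip_to_disk (\<omega> \<alpha>) = fixpt \<alpha>"
  unfolding \<omega>_def using fixpt_cball by (intro strip_to_disk_to_strip) auto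

lemma omega_closure: "\<alpha> \<in> closure strip \<Longrightarrow> \<omega> \<alpha> \<in> closure strip"
  unfolding \<omega>_def using fixpt_cball[of \<alpha>] by (auto simp: closure_strip intro!: disk_to_strip_closed)

text \<open>The source of injectivity of \<open>f\<close>: a solution in the open strip is a fixed
  point of the self-map, hence its only Denjoy-Wolff point.\<close>

lemma omega_eqI:
  assumes "\<alpha> \<in> closure strip" "z \<in> strip" "f z = \<alpha>"
  shows "\<omega> \<alpha> = z"
proof -
  have "fixpt \<alpha> = strip_to_disk z"
    using assms julia_self_map_fixed_point[OF tau0] by (intro fixpt_eqI) auto
  then show ?thesis
    using disk_to_strip_to_disk assms(2) by (simp add: \<omega>_def strip_def)
qed

lemma f_omega:
  assumes "\<alpha> \<in> closure strip" "\<omega> \<alpha> \<in> strip"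
  shows "f (\<omega> \<alpha>) = \<alpha>"
  using julia_self_map_fixed_point[OF tau0 assms] julia_fixpt assms strip_to_disk_omega by simp

lemma omega_strip:
  assumes "\<alpha> \<in> strip"
  shows "\<omega> \<alpha> \<in> strip"
proof -
  have \<alpha>: "\<alpha> \<in> closure strip" using assms strip_subset_closure by blast
  \<comment> \<open>The left side bounds |Im| over all values of the self-map. Being less than pi,
    it keeps the Denjoy-Wolff point off the circle.\<close>
  have "(1 - \<tau>\<^sub>0) * pi + \<tau>\<^sub>0 * \<bar>Im \<alpha>\<bar> < pi"
    using assms tau0 by (simp add: strip_def algebra_simps)
  then have "cmod (fixpt \<alpha>) < 1"
    using fixpt_cball[OF \<alpha>]
    by (intro julia_conj_to_disk_boundary_Im[OF self_map_holomorphic Im_self_map_le[OF tau0] _ julia_fixpt[OF \<alpha>]])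
       (auto intro: tau0)
  then show ?thesis by (simp add: \<omega>_def disk_to_strip_strip)
qed

text \<open>A map into a compact set is continuous once its graph is closed. Here limits of points
  satisfying Julia's inequality satisfy it again, and uniqueness identifies the limit with the value
  of \<open>fixpt\<close>.\<close>

lemma fixpt_continuous: "continuous_on (closure strip) fixpt"
proof (rule continuous_from_closed_graph)
  show "compact (cball (0::complex) 1)" by simp
  show "fixpt \<in> closure strip \<rightarrow> cball 0 1" using fixpt_cball by auto
  show "closed ((\<lambda>x. (x, fixpt x)) ` closure strip)"
    unfolding closed_sequential_limits
  proof (intro allI impI, elim conjE)
    fix X and l :: "complex \<times> complex"
    assume X: "\<forall>n. X n \<in> (\<lambda>x. (x, fixpt x)) ` closure strip" and lim: "X \<longlonglongrightarrow> l"
    have mem: "fst (X n) \<in> closure strip" "snd (X n) = fixpt (fst (X n))" for n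
      using X[rule_format, of n] by auto
    have lims: "(\<lambda>n. fst (X n)) \<longlonglongrightarrow> fst l" "(\<lambda>n. snd (X n)) \<longlonglongrightarrow> snd l"
      using tendsto_fst[OF lim] tendsto_snd[OF lim] by auto
    have l: "fst l \<in> closure strip"
      using mem by (intro closed_sequentially[OF closed_closure _ lims(1)]) simp
    have "julia (conj_to_disk (self_map \<tau>\<^sub>0 f (fst l))) (snd l)"
      using julia_self_map_limit[OF tau0 mem(1) lims] julia_fixpt mem by simp
    then have "l = (fst l, fixpt (fst l))" using fixpt_eqI[OF l] by (simp add: prod_eq_iff)
    then show "l \<in> (\<lambda>x. (x, fixpt x)) ` closure strip" using l by blast
  qed
qed

lemma omega_continuous: "continuous_on (closure strip) \<omega>"
  unfolding \<omega>_def
  by (rule continuous_on_compose2[OF disk_to_strip_continuous fixpt_continuous])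
     (intro image_subsetI fixpt_cball)

lemma julia_omega:
  assumes \<tau>: "0 < \<tau>" "\<tau> \<le> 2 / (k + 1)" and \<alpha>: "\<alpha> \<in> closure strip"
  shows "julia (conj_to_disk (self_map \<tau> f \<alpha>)) (strip_to_disk (\<omega> \<alpha>))"
proof -
  have "\<bar>Im \<alpha>\<bar> \<le> pi" using \<alpha> by (simp add: closure_strip)
  then obtain X where X: "\<And>n. X n \<in> strip" "X \<longlonglongrightarrow> \<alpha>"
    by (rule strip_approximation) blast
  have X': "X n \<in> closure strip" for n by (rule strip_subset_closure[OF X(1)])
  have "(\<lambda>n. fixpt (X n)) \<longlonglongrightarrow> fixpt \<alpha>"
    by (rule continuous_on_tendsto_compose[OF fixpt_continuous X(2) \<alpha>]) (simp add: X')
  moreover have "julia (conj_to_disk (self_map \<tau> f (X n))) (fixpt (X n))" for n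
  proof -
    note w = omega_strip[OF X(1)[of n]]
    have "julia (conj_to_disk (self_map \<tau> f (X n))) (strip_to_disk (\<omega> (X n)))"
      unfolding julia_self_map_fixed_point[OF \<tau> X' w] by (rule f_omega[OF X' w])
    then show ?thesis by (simp only: strip_to_disk_omega[OF X'])
  qed
  ultimately show ?thesis
    unfolding strip_to_disk_omega[OF \<alpha>] by (rule julia_self_map_limit[OF \<tau> X' X(2)])
qed

section \<open>Derivatives, the lower Lipschitz bound and analytic continuation\<close>

text \<open>At a fixed point the derivative of \<open>strip_to_disk\<close> cancels in the chain
  rule, so the disk estimate bounds the derivative of the self-map. If \<open>deriv f z\<close>
  vanished, that derivative would be 1 and the self-map the identity.\<close>

lemma deriv_self_map_fixed_point:
  assumes \<tau>: "0 < \<tau>" "\<tau> \<le> 2 / (k + 1)" and z: "z \<in> strip" and fz: "f z \<in> closure strip"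
  shows "cmod (1 - of_real \<tau> * deriv f z) \<le> 1" "deriv f z \<noteq> 0"
proof -
  let ?g = "self_map \<tau> f (f z)"
  let ?h = "conj_to_disk ?g"
  let ?v = "strip_to_disk z"
  note H = conj_self_map_holomorphic[OF \<tau> fz]
  have v: "cmod ?v < 1" by (rule strip_to_disk_ball[OF z])
  have gz: "?g z = z" by (simp add: self_map_def)
  then have hv: "?h ?v = ?v" using conj_to_disk_strip_to_disk[OF z] by metis
  obtain D where D: "D \<noteq> 0" "(strip_to_disk has_field_derivative D) (at z)"
    using strip_to_disk_has_derivative[OF z] by blast
  have dg: "(?g has_field_derivative 1 - of_real \<tau> * deriv f z) (at z)"
    unfolding self_map_def
    using holomorphic_derivI[OF holf open_strip z, of UNIV] by (auto intro!: derivative_eq_intros)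
  have "(?h has_field_derivative deriv ?h ?v) (at ?v)"
    using holomorphic_derivI[OF H(1), of ?v UNIV] v by simp
  then have "((\<lambda>x. ?h (strip_to_disk x)) has_field_derivative deriv ?h ?v * D) (at z)"
    using D(2) by (rule DERIV_chain2)
  moreover have "((\<lambda>x. ?h (strip_to_disk x)) has_field_derivative D * (1 - of_real \<tau> * deriv f z)) (at z)"
  proof (rule has_field_derivative_transform_within_open[OF _ open_strip z])
    show "((\<lambda>x. strip_to_disk (?g x)) has_field_derivative D * (1 - of_real \<tau> * deriv f z)) (at z)"
      by (rule DERIV_chain2[OF _ dg]) (use D(2) gz in simp)
  qed (simp add: conj_to_disk_strip_to_disk)
  ultimately have eq: "deriv ?h ?v = 1 - of_real \<tau> * deriv f z"
    using D(1) DERIV_unique by fastforce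
  show "cmod (1 - of_real \<tau> * deriv f z) \<le> 1"
    using deriv_fixed_point_ball(1)[OF H v hv] eq by simp
  show "deriv f z \<noteq> 0"
  proof
    assume "deriv f z = 0"
    then have id: "?h x = x" if "cmod x < 1" for x
      using deriv_fixed_point_ball(2)[OF H v hv _ that] eq by simp
    obtain y where y: "y \<in> strip" "f y \<noteq> f z" using f_not_constant by blast
    then show False
      using id[OF strip_to_disk_ball[OF y(1)]] conj_to_disk_fixed_iff[of y ?g] self_map_strip[OF \<tau> y(1) fz]
        self_map_fixed_iff[OF \<tau>] by simp
  qed
qed

text \<open>Because \<open>omega_eqI\<close> admits values in the closed strip, a local inverse of
  \<open>f\<close> agrees with \<omega> up to the boundary, while its open domain may reach
  beyond.\<close>

lemma omega_eq_local_inverse: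
  assumes U: "open U" "U \<subseteq> strip" and inj: "inj_on f U"
  obtains F where "F holomorphic_on f ` U" "open (f ` U)"
    "\<And>\<alpha>. \<alpha> \<in> f ` U \<inter> closure strip \<Longrightarrow> F \<alpha> = \<omega> \<alpha>"
proof -
  have hol: "f holomorphic_on U" by (rule holomorphic_on_subset[OF holf U(2)])
  obtain F where F: "F holomorphic_on f ` U" "\<And>z. z \<in> U \<Longrightarrow> F (f z) = z"
    using holomorphic_has_inverse[OF hol U(1) inj] by metis
  moreover have "open (f ` U)" using open_mapping_thm3[OF hol U(1) inj] .
  moreover have "F \<alpha> = \<omega> \<alpha>" if "\<alpha> \<in> f ` U \<inter> closure strip" for \<alpha>
    using that F(2) omega_eqI[of \<alpha>] U(2) by auto
  ultimately show ?thesis using that by blast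
qed

lemma omega_has_derivative:
  assumes \<alpha>: "\<alpha> \<in> strip"
  shows "(\<omega> has_field_derivative inverse (deriv f (\<omega> \<alpha>))) (at \<alpha>)"
proof -
  \<comment> \<open>Restricting to points whose values lie in the strip makes \<omega> a left
    inverse of \<open>f\<close> on all of \<open>U\<close>, as the inverse function theorem
    asks.\<close>
  define U where "U = {z \<in> strip. f z \<in> strip}"
  have "open (strip \<inter> f -` strip)"
    using continuous_open_preimage[OF holomorphic_on_imp_continuous_on[OF holf] open_strip open_strip] .
  then have U: "open U" by (simp add: U_def Int_def vimage_def)
  have sub: "U \<subseteq> strip" by (auto simp: U_def)
  have mem: "\<omega> \<beta> \<in> U" "f (\<omega> \<beta>) = \<beta>" if "\<beta> \<in> strip" for \<beta>
    using f_omega[OF strip_subset_closure[OF that] omega_strip[OF that]] omega_strip[OF that] that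
    by (simp_all add: U_def)
  show ?thesis
  proof (rule has_field_derivative_inverse_strong_x[where S=U])
    show "(f has_field_derivative deriv f (\<omega> \<alpha>)) (at (\<omega> \<alpha>))"
      using holomorphic_derivI[OF holf open_strip] omega_strip[OF \<alpha>] by blast
    show "deriv f (\<omega> \<alpha>) \<noteq> 0"
      using deriv_self_map_fixed_point(2)[OF tau0 omega_strip[OF \<alpha>]] mem(2)[OF \<alpha>] strip_subset_closure[OF \<alpha>] by simp
    show "continuous_on U f"
      by (rule holomorphic_on_imp_continuous_on[OF holomorphic_on_subset[OF holf sub]])
    show "\<omega> (f z) = z" if "z \<in> U" for z
      using that omega_eqI[OF strip_subset_closure, of "f z" z] by (simp add: U_def)
    show "\<omega> \<alpha> \<in> U" "f (\<omega> \<alpha>) = \<alpha>" by (fact mem[OF \<alpha>])+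
  qed (fact U)
qed

lemma omega_expanding_strip:
  assumes \<tau>: "0 < \<tau>" "\<tau> \<le> 2 / (k + 1)" and a: "a \<in> strip" and b: "b \<in> strip"
  shows "\<tau> / 2 * cmod (a - b) \<le> cmod (\<omega> a - \<omega> b)"
proof (cases "a = b")
  case False
  \<comment> \<open>The mean value theorem used here controls only a real part. With this factor,
    that real part becomes the inner product of \<open>\<omega> a - \<omega> b\<close> with
    \<open>a - b\<close>.\<close>
  define c where "c = cnj (a - b)"
  define D where "D u = inverse (deriv f (\<omega> u))" for u
  have seg: "closed_segment b a \<subseteq> strip"
    using a b convex_strip by (simp add: closed_segment_subset)
  have der: "((\<lambda>u. \<omega> u * c) has_field_derivative D u * c) (at u)" if "u \<in> strip" for u
    using omega_has_derivative[OF that] by (auto intro!: derivative_eq_intros simp: D_def)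
  have Re_D: "\<tau> / 2 \<le> Re (D u)" if u: "u \<in> strip" for u
  proof -
    let ?d = "deriv f (\<omega> u)"
    have "f (\<omega> u) \<in> closure strip"
      using f_omega[OF strip_subset_closure[OF u] omega_strip[OF u]] u strip_subset_closure by simp
    then have d: "cmod (1 - of_real \<tau> * ?d) \<le> 1" "?d \<noteq> 0"
      using deriv_self_map_fixed_point[OF \<tau> omega_strip[OF u]] by auto
    \<comment> \<open>Multiplying the bound on 1 - \<tau> f' by \<open>D u = 1 / f'\<close> shows
      that \<open>D u\<close> is no farther from \<tau> than from 0, hence on or to the right of the
      line Re = \<tau> / 2.\<close>
    have "D u - of_real \<tau> = D u * (1 - of_real \<tau> * ?d)"
      using d by (simp add: D_def field_simps)
    then have "cmod (D u - of_real \<tau>) \<le> cmod (D u)"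
      using d(1) by (simp add: norm_mult mult_left_le)
    then have "(cmod (D u - of_real \<tau>))\<^sup>2 \<le> (cmod (D u))\<^sup>2" by (intro power_mono) auto
    then have "\<tau> * \<tau> \<le> \<tau> * (2 * Re (D u))"
      unfolding cmod_power2 by (simp add: power2_eq_square algebra_simps)
    then show ?thesis using \<tau> by simp
  qed
  obtain u where u: "u \<in> closed_segment b a" "Re (\<omega> a * c) - Re (\<omega> b * c) = Re (D u * c * (a - b))"
    using complex_mvt_line[of b a "\<lambda>u. \<omega> u * c" "\<lambda>u. D u * c"] der seg by blast
  have "c * (a - b) = of_real ((cmod (a - b))\<^sup>2)"
    unfolding c_def complex_norm_square by (rule mult.commute)
  then have "Re (D u * c * (a - b)) = Re (D u) * (cmod (a - b))\<^sup>2"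
    by (simp add: mult.assoc)
  then have eq: "Re ((\<omega> a - \<omega> b) * c) = Re (D u) * (cmod (a - b))\<^sup>2"
    using u(2) by (simp only: left_diff_distrib minus_complex.sel)
  have "\<tau> / 2 * (cmod (a - b))\<^sup>2 \<le> Re ((\<omega> a - \<omega> b) * c)"
    unfolding eq using u(1) seg by (intro mult_right_mono Re_D) auto
  also have "\<dots> \<le> cmod (\<omega> a - \<omega> b) * cmod (a - b)"
    using complex_Re_le_cmod[of "(\<omega> a - \<omega> b) * c"] by (simp only: norm_mult c_def complex_mod_cnj)
  finally show ?thesis using False by (simp add: power2_eq_square flip: mult.assoc)
qed auto

lemma omega_expanding:
  assumes \<tau>: "0 < \<tau>" "\<tau> \<le> 2 / (k + 1)" and a: "a \<in> closure strip" and b: "b \<in> closure strip"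
  shows "\<tau> / 2 * cmod (a - b) \<le> cmod (\<omega> a - \<omega> b)"
proof -
  have Im: "\<bar>Im a\<bar> \<le> pi" "\<bar>Im b\<bar> \<le> pi" using a b by (simp_all add: closure_strip)
  obtain X where X: "\<And>n. X n \<in> strip" "X \<longlonglongrightarrow> a"
    using Im(1) by (rule strip_approximation) blast
  obtain Y where Y: "\<And>n. Y n \<in> strip" "Y \<longlonglongrightarrow> b"
    using Im(2) by (rule strip_approximation) blast
  have "(\<lambda>n. \<omega> (X n)) \<longlonglongrightarrow> \<omega> a" "(\<lambda>n. \<omega> (Y n)) \<longlonglongrightarrow> \<omega> b"
    by (rule continuous_on_tendsto_compose[OF omega_continuous]; simp add: X Y a b strip_subset_closure)+
  then have "(\<lambda>n. cmod (\<omega> (X n) - \<omega> (Y n))) \<longlonglongrightarrow> cmod (\<omega> a - \<omega> b)"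
    by (intro tendsto_intros)
  moreover have "(\<lambda>n. \<tau> / 2 * cmod (X n - Y n)) \<longlonglongrightarrow> \<tau> / 2 * cmod (a - b)"
    by (intro tendsto_intros X Y)
  ultimately show ?thesis
    using omega_expanding_strip[OF \<tau> X(1) Y(1)] by (intro LIMSEQ_le) auto
qed

text \<open>The derivative of \<open>f\<close> at the interior point
  \<open>\<omega> \<alpha>\<close> is nonzero, so \<open>f\<close> is injective nearby, and its
  local inverse is the continuation.\<close>

lemma omega_analytic_continuation:
  assumes \<alpha>: "\<alpha> \<in> closure strip" and "\<omega> \<alpha> \<in> strip"
  shows "\<exists>U F. open U \<and> \<alpha> \<in> U \<and> F holomorphic_on U \<and> (\<forall>z\<in>U \<inter> closure strip. F z = \<omega> z)"
proof -
  have "deriv f (\<omega> \<alpha>) \<noteq> 0"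
    using deriv_self_map_fixed_point(2)[OF tau0 assms(2)] f_omega[OF assms] \<alpha> by simp
  then obtain r where r: "r > 0" "ball (\<omega> \<alpha>) r \<subseteq> strip" "inj_on f (ball (\<omega> \<alpha>) r)"
    using has_complex_derivative_locally_injective[OF holf assms(2) open_strip] by blast
  obtain F where F: "F holomorphic_on f ` ball (\<omega> \<alpha>) r" "open (f ` ball (\<omega> \<alpha>) r)"
    "\<And>z. z \<in> f ` ball (\<omega> \<alpha>) r \<inter> closure strip \<Longrightarrow> F z = \<omega> z"
    using omega_eq_local_inverse[OF open_ball r(2,3)] by metis
  moreover have "\<alpha> \<in> f ` ball (\<omega> \<alpha>) r"
    using f_omega[OF assms] r(1) by (intro image_eqI[of _ _ "\<omega> \<alpha>"]) auto
  ultimately show ?thesis by blast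
qed

lemma is_strip_denjoy_wolff_point_omega:
  assumes \<tau>: "0 < \<tau>" "\<tau> \<le> 2 / (k + 1)" and \<alpha>: "\<alpha> \<in> closure strip"
  shows "is_strip_denjoy_wolff_point (self_map \<tau> f \<alpha>) (\<omega> \<alpha>)"
  unfolding is_strip_denjoy_wolff_point_def
  using omega_closure[OF \<alpha>] denjoy_wolff_point_iff_julia[OF conj_self_map_holomorphic[OF \<tau> \<alpha>]]
    julia_omega[OF assms] julia_self_map_unique[OF \<tau> \<alpha>] by blast

lemma omega_strip_properties:
  assumes z: "z \<in> strip"
  shows "\<bar>Im (\<omega> z)\<bar> \<le> \<bar>Im z\<bar>" "\<omega> (cnj z) = cnj (\<omega> z)" "f (\<omega> z) = z"
proof -
  note w = omega_strip[OF z]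
  show fw: "f (\<omega> z) = z" using f_omega[OF strip_subset_closure[OF z] w] .
  show "\<bar>Im (\<omega> z)\<bar> \<le> \<bar>Im z\<bar>" using abs_Im_f_ge[OF w] fw by simp
  show "\<omega> (cnj z) = cnj (\<omega> z)"
  proof (rule omega_eqI)
    show "cnj z \<in> closure strip" using z by (intro strip_subset_closure) (simp add: strip_def)
    show "cnj (\<omega> z) \<in> strip" using w by (simp add: strip_def)
    show "f (cnj (\<omega> z)) = cnj z" using cnj_f[OF w] fw by simp
  qed
qed

end

text \<open>The symmetry makes \<open>f\<close> real on the real axis, so the limit at -infinity is
  stated for \<open>Re\<close>. A single \<omega> serves all admissible \<tau> at once.\<close>

theorem theorem2p16:
  fixes f :: "complex \<Rightarrow> complex" and k :: real
  assumes "f holomorphic_on strip"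
    and "\<And>z. z \<in> strip \<Longrightarrow> f (cnj z) = cnj (f z)"
    and "k > 1"
    and "filterlim (\<lambda>t::real. k * t + Re (f (of_real t))) at_bot at_bot"
    and "\<And>z. z \<in> strip \<Longrightarrow> Im z > 0 \<Longrightarrow> Im z \<le> Im (f z) \<and> Im (f z) \<le> k * Im z"
  shows "(\<forall>\<alpha>\<in>strip. \<exists>!z. z \<in> strip \<and> f z = \<alpha>) \<and>
    (\<exists>\<omega> :: complex \<Rightarrow> complex.
       (continuous_on (closure strip) \<omega> \<and> \<omega> ` closure strip \<subseteq> closure strip \<and>
        \<omega> ` strip \<subseteq> strip \<and> \<omega> holomorphic_on strip \<and>
        (\<forall>z\<in>strip. \<bar>Im (\<omega> z)\<bar> \<le> \<bar>Im z\<bar> \<and> \<omega> (cnj z) = cnj (\<omega> z) \<and> f (\<omega> z) = z)) \<and>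
       (\<forall>\<tau>::real. 0 < \<tau> \<and> \<tau> \<le> 2 / (k + 1) \<longrightarrow>
          (\<forall>\<alpha>\<in>closure strip.
             self_map \<tau> f \<alpha> ` strip \<subseteq> strip \<and>
             is_strip_denjoy_wolff_point (self_map \<tau> f \<alpha>) (\<omega> \<alpha>)) \<and>
          (\<forall>z1\<in>closure strip. \<forall>z2\<in>closure strip.
             cmod (\<omega> z1 - \<omega> z2) \<ge> \<tau> / 2 * cmod (z1 - z2))) \<and>
       inj_on \<omega> (closure strip) \<and>
       (\<forall>\<alpha>\<in>frontier strip. \<omega> \<alpha> \<in> strip \<longrightarrow>
          (\<exists>U F. open U \<and> \<alpha> \<in> U \<and> F holomorphic_on U \<and>
             (\<forall>z\<in>U \<inter> closure strip. F z = \<omega> z))))"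
proof -
  interpret strip_inner_map f k
    using assms by unfold_locales auto
  have inj: "inj_on \<omega> (closure strip)"
  proof (rule inj_onI)
    fix a b assume "a \<in> closure strip" "b \<in> closure strip" "\<omega> a = \<omega> b"
    then have "\<tau>\<^sub>0 / 2 * cmod (a - b) \<le> 0" using omega_expanding[OF tau0, of a b] by simp
    then show "a = b" using tau0 by (simp add: mult_le_0_iff)
  qed
  show ?thesis
  proof (intro conjI exI[of _ \<omega>] ballI allI impI)
    fix \<alpha> assume \<alpha>: "\<alpha> \<in> strip"
    show "\<exists>!z. z \<in> strip \<and> f z = \<alpha>"
    proof (rule ex1I)
      show "\<omega> \<alpha> \<in> strip \<and> f (\<omega> \<alpha>) = \<alpha>"
        using omega_strip[OF \<alpha>] omega_strip_properties(3)[OF \<alpha>] by blast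
      show "z = \<omega> \<alpha>" if "z \<in> strip \<and> f z = \<alpha>" for z
        using omega_eqI[OF strip_subset_closure[OF \<alpha>], of z] that by simp
    qed
  next
    show "\<omega> holomorphic_on strip"
      using omega_has_derivative open_strip by (auto simp: holomorphic_on_open)
  next
    fix \<tau> \<alpha> assume "0 < \<tau> \<and> \<tau> \<le> 2 / (k + 1)" "\<alpha> \<in> closure strip"
    then show "self_map \<tau> f \<alpha> ` strip \<subseteq> strip" "is_strip_denjoy_wolff_point (self_map \<tau> f \<alpha>) (\<omega> \<alpha>)"
      by (auto intro: self_map_strip is_strip_denjoy_wolff_point_omega)
  next
    fix \<alpha> assume "\<alpha> \<in> frontier strip" "\<omega> \<alpha> \<in> strip"
    then show "\<exists>U F. open U \<and> \<alpha> \<in> U \<and> F holomorphic_on U \<and> (\<forall>z\<in>U \<inter> closure strip. F z = \<omega> z)"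
      by (intro omega_analytic_continuation) (simp_all add: frontier_def)
  next
    show "\<tau> / 2 * cmod (z1 - z2) \<le> cmod (\<omega> z1 - \<omega> z2)"
      if "0 < \<tau> \<and> \<tau> \<le> 2 / (k + 1)" "z1 \<in> closure strip" "z2 \<in> closure strip" for \<tau> z1 z2
      using omega_expanding that by blast
  qed (use omega_continuous omega_closure omega_strip omega_strip_properties inj in auto)
qed

end
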